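(* Let $(u_n)_{n\ge 0}$ be the sequence defined by the recurrence $$u_0=1,\qquad u_{n+1}=1-\left(1-\frac{u_n}{q^{d-1}}\right)^{q^{d-1}}.$$ Then, for every positive integer $n$, $$\mathbb E[X_n]=1-(1-u_n)^{1+q^{-1}+\cdots+q^{-(d-1)}}.$$
   Context: $K$ is a field complete with respect to a discrete valuation $\mathrm{val}$ normalized by $\mathrm{val}(\pi)=1$ for a uniformizer $\pi$; $R$ is its ring of integers, $\mathfrak m=\pi R$ its maximal ideal, and the residue field $k=R/\mathfrak m$ is finite with $q$ elements. The norm is $|x|=q^{-\mathrm{val}(x)}$, and $d\ge 2$ is an integer. $K^d$ is equipped with $\|(x_1,\dots,x_d)\|_\infty=\max_i|x_i|$ and with the Haar measure $\mu$ normalized by $\mu(R^d)=1$. $\mathbb S^{d-1}(K)=\{x\in K^d:\|x\|_\infty=1\}$. $\mathbb P^{d-1}(K)$ is the set of lines through $0$ in $K^d$, identified with $\mathbb S^{d-1}(K)/R^\times$, with the distance $\mathrm{dist}(a,b)=\inf\|\hat a-\hat b\|_\infty$, the infimum being over all representatives $\hat a,\hat b\in\mathbb S^{d-1}(K)$ of $a$ and $b$. For $a\in\mathbb P^{d-1}(K)$, $\mathrm{can}(a)=(a_1,\dots,a_d)\in\mathbb S^{d-1}(K)$ is the unique representative of $a$ for which there is an index $j$ with $a_j=1$ and $|a_i|<1$ for all $i<j$. $\Omega$ is the set of $1$-Lipschitz functions $\mathbb P^{d-1}(K)\to R^d$. It is a group under pointwise addition, compact for the topology of uniform convergence, and is equipped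 with its Haar probability measure, with respect to which the expectation $\mathbb E$ is taken. For $f\in\Omega$ set $$N(f)=\bigcup_{a\in\mathbb P^{d-1}(K)}\{t\cdot\mathrm{can}(a)+f(a): t\in R\}\subset R^d,$$ and for a positive integer $n$ let $X_n(f)=\mu(N_n(f))$, where $N_n(f)=\{x\in R^d:\inf_{y\in N(f)}\|x-y\|_\infty\le q^{-n}\}$. *)

theory Defs
  imports "HOL-Probability.Probability"
begin

section \<open>Haar measures\<close>

text \<open>
  The underlying set of the topological group is the carrier of the topology \<open>T\<close>, and \<open>add\<close> is
  its (commutative) operation. Regularity is not listed: the groups considered here are locally
  compact and second countable, where every Borel measure that is finite on compact sets is regular.
\<close>

definition haar_measure :: "'a topology \<Rightarrow> ('a \<Rightarrow> 'a \<Rightarrow> 'a) \<Rightarrow> 'a measure \<Rightarrow> bool" where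
  "haar_measure T add M \<longleftrightarrow>
     space M = topspace T \<and>
     sets M = sigma_sets (topspace T) {U. openin T U} \<and>
     (\<forall>g\<in>topspace T. \<forall>A\<in>sets M. emeasure M (add g ` A) = emeasure M A) \<and>
     (\<forall>C. compactin T C \<longrightarrow> emeasure M C < \<infinity>) \<and>
     emeasure M (space M) \<noteq> 0"


section \<open>Fields with a discrete valuation\<close>

text \<open>
  The valuation takes values in \<^typ>\<open>int\<close>, so \<open>val 0\<close> is unspecified (it should be
  \<open>\<infinity>\<close>); zero is treated separately wherever \<open>val\<close> is used.
\<close>

locale discretely_valued_field =
  fixes val :: "'k::field \<Rightarrow> int" and \<pi> :: 'k
  assumes val_mult: "\<lbrakk>x \<noteq> 0; y \<noteq> 0\<rbrakk> \<Longrightarrow> val (x * y) = val x + val y"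
    and val_add: "\<lbrakk>x \<noteq> 0; y \<noteq> 0; x + y \<noteq> 0\<rbrakk> \<Longrightarrow> min (val x) (val y) \<le> val (x + y)"
    and uniformizer_nonzero: "\<pi> \<noteq> 0"
    and val_uniformizer: "val \<pi> = 1"
begin

definition R :: "'k set" where
  "R = {x. x = 0 \<or> 0 \<le> val x}"

definition \<mm> :: "'k set" where
  "\<mm> = (\<lambda>x. \<pi> * x) ` R"

definition residue_field :: "'k set set" where
  "residue_field = R // {(x, y). x \<in> R \<and> y \<in> R \<and> x - y \<in> \<mm>}"

definition q :: nat where
  "q = card residue_field"

definition absv :: "'k \<Rightarrow> real" where
  "absv x = (if x = 0 then 0 else real q powi (- val x))"

definition supnorm :: "'k ^ 'd::finite \<Rightarrow> real" where
  "supnorm x = Max (range (\<lambda>i. absv (x $ i)))"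

definition vec_topology :: "('k ^ 'd::finite) topology" where
  "vec_topology = Metric_space.mtopology UNIV (\<lambda>x y. supnorm (x - y))"

definition Rd :: "('k ^ 'd::finite) set" where
  "Rd = {x. \<forall>i. x $ i \<in> R}"

definition unit_sphere :: "('k ^ 'd::finite) set" where
  "unit_sphere = {x. supnorm x = 1}"


subsection \<open>Projective space\<close>

text \<open>
  A point is a line, as a subset of \<open>K\<^sup>d\<close>; its representatives in the sphere (an orbit of
  the units of \<open>R\<close>) are the elements of its intersection with \<open>unit_sphere\<close>.
\<close>

definition proj_space :: "('k ^ 'd::finite) set set" where
  "proj_space = {vec.span {v} |v. v \<noteq> 0}"

definition proj_dist :: "('k ^ 'd::finite) set \<Rightarrow> ('k ^ 'd) set \<Rightarrow> real" where
  "proj_dist a b = Inf {supnorm (x - y) |x y. x \<in> a \<inter> unit_sphere \<and> y \<in> b \<inter> unit_sphere}"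

definition is_can :: "('k ^ 'd::{finite,linorder}) set \<Rightarrow> 'k ^ 'd::{finite,linorder} \<Rightarrow> bool" where
  "is_can a x \<longleftrightarrow> x \<in> a \<inter> unit_sphere \<and> (\<exists>j. x $ j = 1 \<and> (\<forall>i<j. absv (x $ i) < 1))"

definition can :: "('k ^ 'd::{finite,linorder}) set \<Rightarrow> 'k ^ 'd::{finite,linorder}" where
  "can a = (THE x. is_can a x)"


subsection \<open>Random 1-Lipschitz functions and Kakeya sets\<close>

text \<open>
  Functions on \<open>proj_space\<close> are extensional (\<^const>\<open>undefined\<close> outside of it), so
  that each is represented by exactly one HOL function.
\<close>

definition \<Omega> :: "(('k ^ 'd::finite) set \<Rightarrow> 'k ^ 'd) set" where
  "\<Omega> = {f \<in> proj_space \<rightarrow>\<^sub>E Rd.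
          \<forall>a\<in>proj_space. \<forall>b\<in>proj_space. supnorm (f a - f b) \<le> proj_dist a b}"

definition add\<Omega> ::
  "(('k ^ 'd::finite) set \<Rightarrow> 'k ^ 'd) \<Rightarrow> (('k ^ 'd) set \<Rightarrow> 'k ^ 'd) \<Rightarrow> ('k ^ 'd) set \<Rightarrow> 'k ^ 'd" where
  "add\<Omega> f g = (\<lambda>a\<in>proj_space. f a + g a)"

text \<open>
  The uniform distance. It is set to \<open>0\<close> outside of \<open>\<Omega>\<close>, where the supremum could
  be unspecified, because \<^const>\<open>Metric_space\<close> requires nonnegativity on the whole type.
\<close>

definition \<Omega>_dist ::
  "(('k ^ 'd::finite) set \<Rightarrow> 'k ^ 'd) \<Rightarrow> (('k ^ 'd) set \<Rightarrow> 'k ^ 'd) \<Rightarrow> real" where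
  "\<Omega>_dist f g =
     (if f \<in> \<Omega> \<and> g \<in> \<Omega> then SUP a\<in>proj_space. supnorm (f a - g a) else 0)"

definition \<Omega>_topology :: "(('k ^ 'd::finite) set \<Rightarrow> 'k ^ 'd) topology" where
  "\<Omega>_topology = Metric_space.mtopology \<Omega> \<Omega>_dist"

definition kakeya :: "(('k ^ 'd::{finite,linorder}) set \<Rightarrow> 'k ^ 'd::{finite,linorder}) \<Rightarrow> ('k ^ 'd::{finite,linorder}) set" where
  "kakeya f = (\<Union>a\<in>proj_space. {t *s can a + f a |t. t \<in> R})"

definition kakeya_nbhd ::
  "nat \<Rightarrow> (('k ^ 'd::{finite,linorder}) set \<Rightarrow> 'k ^ 'd::{finite,linorder}) \<Rightarrow> ('k ^ 'd::{finite,linorder}) set" where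
  "kakeya_nbhd n f = {x \<in> Rd. (INF y\<in>kakeya f. supnorm (x - y)) \<le> 1 / real q ^ n}"

definition X ::
  "('k ^ 'd::{finite,linorder}) measure \<Rightarrow> nat \<Rightarrow> (('k ^ 'd::{finite,linorder}) set \<Rightarrow> 'k ^ 'd::{finite,linorder}) \<Rightarrow> real" where
  "X \<mu> n f = measure \<mu> (kakeya_nbhd n f)"

end

locale complete_dvf = discretely_valued_field val \<pi>
  for val :: "'k::field \<Rightarrow> int" and \<pi> +
  assumes finite_residue_field: "finite residue_field"
    and complete: "Metric_space.mcomplete UNIV (\<lambda>x y. absv (x - y))"
begin

lemma val_one: "val 1 = 0"
  using val_mult[of 1 1] by simp

lemma val_minus: "val (- x) = val x"
proof (cases "x = 0")
  case False
  have "val (-1) + val (-1) = 0"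
    using val_mult[of "-1" "-1"] val_one by simp
  then show ?thesis
    using val_mult[of "-1" x] False by simp
qed simp

lemma one_notin_\<mm>: "1 \<notin> \<mm>"
proof
  assume "1 \<in> \<mm>"
  then obtain x where x: "x \<in> R" "1 = \<pi> * x"
    by (auto simp: \<mm>_def)
  then have "x \<noteq> 0" by auto
  then show False
    using x val_mult[of \<pi> x] uniformizer_nonzero val_uniformizer val_one by (auto simp: R_def)
qed

lemma q_gt_1: "1 < q"
proof -
  let ?r = "{(x, y). x \<in> R \<and> y \<in> R \<and> x - y \<in> \<mm>}"
  have R: "0 \<in> R" "1 \<in> R"
    by (auto simp: R_def val_one)
  have "0 \<in> \<mm>"
    using R by (auto simp: \<mm>_def image_iff intro!: bexI[of _ 0])
  then have "0 \<in> ?r `` {0}" "0 \<notin> ?r `` {1}"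
    using R one_notin_\<mm> by auto
  then have "?r `` {0} \<noteq> ?r `` {1}"
    by blast
  moreover have "{?r `` {0}, ?r `` {1}} \<subseteq> residue_field"
    using quotientI[OF R(1), of ?r] quotientI[OF R(2), of ?r]
    by (simp only: residue_field_def insert_subset empty_subsetI simp_thms)
  ultimately show ?thesis
    using card_mono[OF finite_residue_field, of "{?r `` {0}, ?r `` {1}}"] by (simp add: q_def)
qed

lemma absv_nonneg: "0 \<le> absv x"
  by (simp add: absv_def)

lemma absv_eq_0: "absv x = 0 \<longleftrightarrow> x = 0"
  using q_gt_1 by (simp add: absv_def)

lemma absv_minus: "absv (- x) = absv x"
  by (simp add: absv_def val_minus)

lemma absv_one: "absv 1 = 1"
  by (simp add: absv_def val_one)

lemma absv_mult: "absv (x * y) = absv x * absv y"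
  using q_gt_1 power_int_add[of "real q" "- val x" "- val y"] by (auto simp: absv_def val_mult)

lemma absv_add: "absv (x + y) \<le> max (absv x) (absv y)"
proof (cases "x = 0 \<or> y = 0 \<or> x + y = 0")
  case True
  then show ?thesis
    using absv_eq_0[of 0] absv_nonneg[of x] absv_nonneg[of y] by auto
next
  case False
  then have "val x \<le> val (x + y) \<or> val y \<le> val (x + y)"
    using val_add[of x y] by linarith
  moreover have "real q powi (- b) \<le> real q powi (- a)" if "a \<le> b" for a b
    using that q_gt_1 by (intro power_int_increasing) auto
  ultimately show ?thesis
    using False by (auto simp: absv_def le_max_iff_disj)
qed

lemma absv_le_supnorm: "absv (x $ i) \<le> supnorm x"
  by (simp add: supnorm_def)

lemma supnorm_le_iff: "supnorm x \<le> c \<longleftrightarrow> (\<forall>i. absv (x $ i) \<le> c)"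
  by (auto simp: supnorm_def)

lemma supnorm_attained: "\<exists>i. supnorm x = absv (x $ i)"
proof -
  have "supnorm x \<in> range (\<lambda>i. absv (x $ i))"
    unfolding supnorm_def by (rule Max_in) auto
  then show ?thesis by auto
qed

lemma supnorm_nonneg: "0 \<le> supnorm x"
  using supnorm_attained[of x] absv_nonneg by auto

lemma supnorm_eq_0: "supnorm x = 0 \<longleftrightarrow> x = 0"
proof
  assume "supnorm x = 0"
  then have "absv (x $ i) = 0" for i
    using absv_le_supnorm[of x i] absv_nonneg[of "x $ i"] by simp
  then show "x = 0"
    by (simp add: vec_eq_iff absv_eq_0)
next
  assume "x = 0"
  then show "supnorm x = 0"
    using supnorm_attained[of x] by (auto simp: absv_eq_0)
qed

lemma supnorm_scale: "supnorm (c *s x) = absv c * supnorm x"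
proof (rule order_antisym)
  show "supnorm (c *s x) \<le> absv c * supnorm x"
    by (simp add: supnorm_le_iff absv_mult absv_le_supnorm absv_nonneg mult_left_mono)
  show "absv c * supnorm x \<le> supnorm (c *s x)"
    using supnorm_attained[of x] absv_le_supnorm[of "c *s x"] by (auto simp: absv_mult)
qed

lemma supnorm_add: "supnorm (x + y) \<le> max (supnorm x) (supnorm y)"
proof -
  obtain i where "supnorm (x + y) = absv (x $ i + y $ i)"
    using supnorm_attained[of "x + y"] by auto
  then show ?thesis
    using absv_add[of "x $ i" "y $ i"] absv_le_supnorm[of x i] absv_le_supnorm[of y i] by linarith
qed

lemma supnorm_minus: "supnorm (- x) = supnorm x"
  by (simp add: supnorm_def absv_minus)

lemma Metric_space_absv: "Metric_space UNIV (\<lambda>x y. absv (x - y))"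
proof
  fix x y z
  show "absv (x - z) \<le> absv (x - y) + absv (y - z)"
    using absv_add[of "x - y" "y - z"] absv_nonneg[of "x - y"] absv_nonneg[of "y - z"] by simp
  show "absv (x - y) = absv (y - x)"
    using absv_minus[of "x - y"] by simp
qed (auto simp: absv_nonneg absv_eq_0)

lemma Metric_space_supnorm: "Metric_space UNIV (\<lambda>x y. supnorm (x - y))"
proof
  fix x y z :: "'k ^ 'b"
  show "supnorm (x - z) \<le> supnorm (x - y) + supnorm (y - z)"
    using supnorm_add[of "x - y" "y - z"] supnorm_nonneg[of "x - y"] supnorm_nonneg[of "y - z"]
    by simp
  show "supnorm (x - y) = supnorm (y - x)"
    using supnorm_minus[of "x - y"] by simp
qed (auto simp: supnorm_nonneg supnorm_eq_0)

lemma supnorm_le_1_if_Rd: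
  assumes "x \<in> Rd"
  shows "supnorm x \<le> 1"
proof -
  have "absv y \<le> 1" if "y \<in> R" for y
    using that q_gt_1 power_int_increasing[of "- val y" 0 "real q"] by (auto simp: R_def absv_def)
  then show ?thesis
    using assms by (simp add: supnorm_le_iff Rd_def)
qed

lemma proj_space_nonempty: "proj_space \<noteq> {}"
proof -
  have "(\<chi> i. 1) \<noteq> (0 :: 'k ^ 'd::finite)"
    by (simp add: vec_eq_iff)
  then show ?thesis
    by (auto simp: proj_space_def)
qed

lemma Metric_space_\<Omega>:
  "Metric_space (\<Omega> :: (('k ^ 'd::finite) set \<Rightarrow> 'k ^ 'd) set) \<Omega>_dist"
proof -
  let ?d = "\<lambda>(f :: ('k ^ 'd) set \<Rightarrow> 'k ^ 'd) g a. supnorm (f a - g a)"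
  let ?L = "\<Omega> :: (('k ^ 'd) set \<Rightarrow> 'k ^ 'd) set"
  interpret V: Metric_space UNIV "\<lambda>x y :: 'k ^ 'd. supnorm (x - y)"
    by (rule Metric_space_supnorm)
  have bdd: "bdd_above (?d f g ` proj_space)" if "f \<in> ?L" "g \<in> ?L" for f g
  proof (rule bdd_aboveI2)
    fix a assume "a \<in> (proj_space :: ('k ^ 'd) set set)"
    then have "supnorm (f a) \<le> 1" "supnorm (g a) \<le> 1"
      using that by (auto simp: \<Omega>_def PiE_iff intro!: supnorm_le_1_if_Rd)
    then show "?d f g a \<le> 1"
      using supnorm_add[of "f a" "- g a"] by (simp add: supnorm_minus)
  qed
  have le: "?d f g a \<le> \<Omega>_dist f g" if "f \<in> ?L" "g \<in> ?L" "a \<in> proj_space" for f g a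
    using that by (auto simp: \<Omega>_dist_def intro!: cSUP_upper bdd)
  have ge: "\<Omega>_dist f g \<le> c"
    if "f \<in> ?L" "g \<in> ?L" "\<And>a. a \<in> proj_space \<Longrightarrow> ?d f g a \<le> c" for f g c
    using that proj_space_nonempty by (auto simp: \<Omega>_dist_def intro!: cSUP_least)
  obtain a0 where a0: "a0 \<in> (proj_space :: ('k ^ 'd) set set)"
    using proj_space_nonempty by blast
  have nonneg: "0 \<le> \<Omega>_dist f g" for f g :: "('k ^ 'd) set \<Rightarrow> 'k ^ 'd"
  proof (cases "f \<in> ?L \<and> g \<in> ?L")
    case True
    then show ?thesis
      using le[of f g a0] a0 supnorm_nonneg[of "f a0 - g a0"] by linarith
  qed (auto simp: \<Omega>_dist_def)
  show ?thesis
  proof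
    fix f g h :: "('k ^ 'd) set \<Rightarrow> 'k ^ 'd"
    show "0 \<le> \<Omega>_dist f g"
      by (rule nonneg)
    show "\<Omega>_dist f g = \<Omega>_dist g f"
      using V.commute by (simp add: \<Omega>_dist_def conj_commute)
    assume fg: "f \<in> ?L" "g \<in> ?L"
    show "\<Omega>_dist f g = 0 \<longleftrightarrow> f = g"
    proof
      assume "\<Omega>_dist f g = 0"
      then have "f a = g a" if "a \<in> proj_space" for a
        using le[OF fg that] supnorm_nonneg[of "f a - g a"] supnorm_eq_0[of "f a - g a"] by simp
      then show "f = g"
        using fg by (auto simp: \<Omega>_def intro: PiE_ext)
    next
      assume "f = g"
      then show "\<Omega>_dist f g = 0"
        using ge[OF fg, of 0] nonneg[of f g] supnorm_eq_0[of "0 :: 'k ^ 'd"]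
        by (simp add: order_antisym)
    qed
    assume h: "h \<in> ?L"
    show "\<Omega>_dist f h \<le> \<Omega>_dist f g + \<Omega>_dist g h"
    proof (rule ge[OF fg(1) h])
      fix a assume a: "a \<in> (proj_space :: ('k ^ 'd) set set)"
      show "?d f h a \<le> \<Omega>_dist f g + \<Omega>_dist g h"
        using V.triangle[of "f a" "g a" "h a"] le[OF fg a] le[OF fg(2) h a] by simp
    qed
  qed
qed

lemma ex1_can:
  fixes a :: "('k ^ 'd::{finite,linorder}) set"
  assumes "a \<in> proj_space"
  shows "\<exists>!x. is_can a x"
proof -
  obtain v where v: "v \<noteq> 0" and a: "a = range (\<lambda>c. c *s v)"
    using assms by (auto simp: proj_space_def vec.span_singleton)
  define I where "I = {i. absv (v $ i) = supnorm v}"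
  have "I \<noteq> {}"
    using supnorm_attained[of v] by (auto simp: I_def)
  define j where "j = Min I"
  have j: "absv (v $ j) = supnorm v"
    using Min_in[of I] \<open>I \<noteq> {}\<close> by (simp add: I_def j_def)
  have less: "absv (v $ i) < supnorm v" if "i < j" for i
  proof -
    have "i \<notin> I"
      using that Min_le[OF finite, of i I] unfolding j_def by (meson leD)
    then show ?thesis
      using absv_le_supnorm[of v i] unfolding I_def less_le by blast
  qed
  have pos: "supnorm v > 0"
    using v supnorm_nonneg[of v] supnorm_eq_0[of v] unfolding less_le by metis
  then have vj: "v $ j \<noteq> 0"
    using j absv_eq_0[of "v $ j"] by auto
  have inv: "absv (inverse (v $ j)) * supnorm v = 1"
    using absv_mult[of "inverse (v $ j)" "v $ j"] vj j by (simp add: absv_one)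
  then have inv_pos: "absv (inverse (v $ j)) > 0"
    using absv_nonneg[of "inverse (v $ j)"] by (cases "absv (inverse (v $ j)) = 0") auto
  show ?thesis
  proof (rule ex1I)
    have "absv (inverse (v $ j) * v $ i) < 1" if "i < j" for i
      using mult_strict_left_mono[OF less[OF that] inv_pos] inv by (simp add: absv_mult)
    then show "is_can a (inverse (v $ j) *s v)"
      using vj inv by (auto simp: is_can_def a unit_sphere_def supnorm_scale intro!: exI[of _ j])
  next
    fix x assume "is_can a x"
    then obtain c where c: "x = c *s v"
      by (auto simp: is_can_def a)
    then have sup: "absv c * supnorm v = 1"
      using \<open>is_can a x\<close> by (simp add: is_can_def unit_sphere_def supnorm_scale)
    obtain k where k: "c * v $ k = 1" "\<And>i. i < k \<Longrightarrow> absv (c * v $ i) < 1"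
      using \<open>is_can a x\<close> c by (auto simp: is_can_def)
    have "absv (v $ k) = supnorm v"
    proof -
      have "absv c * absv (v $ k) = absv c * supnorm v"
        using absv_mult[of c "v $ k"] k(1) sup absv_one by simp
      moreover have "absv c \<noteq> 0"
        using sup by auto
      ultimately show ?thesis by simp
    qed
    then have "\<not> k < j"
      using less by force
    moreover have "\<not> j < k"
      using k(2)[of j] sup j absv_mult[of c "v $ j"] by auto
    ultimately have "k = j" by simp
    then have "c = inverse (v $ j)"
      using k(1) vj by (simp add: field_simps)
    then show "x = inverse (v $ j) *s v"
      using c by simp
  qed
qed

end

end

theory Submission
  imports Defs
begin

text \<open>
  Translating \<open>f\<close> by a constant shows that the probability that a given point lies in the
  \<open>q\<^sup>-\<^sup>n\<close>-neighbourhood of \<open>N(f)\<close> does not depend on the point, so the expectation is the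
  probability that \<open>0\<close> lies in it. Invariance of the Haar measure makes the reduction of \<open>f\<close>
  modulo \<open>\<pi>\<^sup>n\<close> uniformly distributed on a finite set of maps, which are labellings of the
  tree of points of projective space modulo \<open>\<pi>, \<pi>\<^sup>2, \<dots>, \<pi>\<^sup>n\<close>. A vertex \<open>a\<close> of level \<open>k\<close>
  survives if \<open>f(a)\<close> lies in \<open>R a\<close> modulo \<open>\<pi>\<^sup>k\<close>. Given that its parent survives, it
  survives with probability \<open>q / q\<^sup>d\<close>, independently of its siblings; every vertex below the root
  has \<open>q\<^sup>d\<^sup>-\<^sup>1\<close> children and the root has \<open>1 + q + \<dots> + q\<^sup>d\<^sup>-\<^sup>1\<close>. Hence \<open>u m\<close> is the
  probability that a surviving vertex has surviving descendants \<open>m\<close> levels below it.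
\<close>

section \<open>Random labellings of a tree\<close>

text \<open>Norms on \<open>Rd\<close> take only the values 0 and q^-j, so a map is 1-Lipschitz
  exactly when it preserves congruence modulo every power of the uniformizer. This turns the problem
  into counting in finite sets: a compatible labelling always extends to a 1-Lipschitz map, the maps
  with a given reduction form a translate of one fixed set, and independence of siblings becomes a
  product formula for cardinalities. The distance on projective space is an infimum over
  representatives; it has to be identified with the distance between canonical representatives
  before the points form a tree of balls. The exponent reflects the exceptional root. If it has M
  children and every other inner vertex has Q = q^(d-1), then the labellings without surviving leaf
  have proportion (1 - u_(n-1)/Q)^M = (1 - u_n)^(M/Q), and M/Q = 1 + q^-1 + ... + q^-(d-1).\<close>

locale level_functions =
  fixes A :: "'a set" and Y :: "'b set" and n :: nat
    and pA :: "nat \<Rightarrow> 'a \<Rightarrow> 'c" and pY :: "nat \<Rightarrow> 'b \<Rightarrow> 'e"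
  assumes finite_A: "finite A" and finite_Y: "finite Y"
    and pA_mono: "\<And>j k a b. \<lbrakk>pA k a = pA k b; j \<le> k\<rbrakk> \<Longrightarrow> pA j a = pA j b"
    and pY_mono: "\<And>j k y z. \<lbrakk>pY k y = pY k z; j \<le> k\<rbrakk> \<Longrightarrow> pY j y = pY j z"
    and inj_pA: "inj_on (pA n) A" and inj_pY: "inj_on (pY n) Y"
begin

text \<open>The elements of \<open>A\<close> and \<open>Y\<close> are the leaves of two trees of
  height \<open>n\<close>, and \<open>pA k a\<close> is the ancestor of the leaf \<open>a\<close> at
  level \<open>k\<close>. So a vertex is handled through the set of leaves below it.\<close>

definition fibA :: "nat \<Rightarrow> 'c \<Rightarrow> 'a set" where
  "fibA k v = {a \<in> A. pA k a = v}"

definition fibY :: "nat \<Rightarrow> 'e \<Rightarrow> 'b set" where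
  "fibY k w = {y \<in> Y. pY k y = w}"

definition compat :: "'a set \<Rightarrow> ('a \<Rightarrow> 'b) \<Rightarrow> bool" where
  "compat S g \<longleftrightarrow> (\<forall>j\<le>n. \<forall>a\<in>S. \<forall>b\<in>S. pA j a = pA j b \<longrightarrow> pY j (g a) = pY j (g b))"

text \<open>Labellings of the subtree below \<open>v\<close>, given that \<open>v\<close> itself is
  labelled \<open>w\<close>. The condition \<Phi> is imposed on leaves only; leaving it arbitrary
  lets one recursion count both all labellings and those without surviving leaf.\<close>

definition funs :: "('a \<Rightarrow> 'b \<Rightarrow> bool) \<Rightarrow> nat \<Rightarrow> 'c \<Rightarrow> 'e \<Rightarrow> ('a \<Rightarrow> 'b) set" where
  "funs \<Phi> k v w =
     {g \<in> fibA k v \<rightarrow>\<^sub>E fibY k w. compat (fibA k v) g \<and> (\<forall>a\<in>fibA k v. \<Phi> a (g a))}"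

lemma funsD:
  assumes "g \<in> funs \<Phi> k v w" "a \<in> fibA k v"
  shows "g a \<in> fibY k w" "\<Phi> a (g a)"
    and "\<lbrakk>j \<le> n; b \<in> fibA k v; pA j a = pA j b\<rbrakk> \<Longrightarrow> pY j (g a) = pY j (g b)"
proof -
  show "g a \<in> fibY k w" "\<Phi> a (g a)"
    using assms unfolding funs_def by auto
  show "\<lbrakk>j \<le> n; b \<in> fibA k v; pA j a = pA j b\<rbrakk> \<Longrightarrow> pY j (g a) = pY j (g b)"
    using assms unfolding funs_def compat_def by blast
qed

lemma finite_fibA: "finite (fibA k v)"
  using finite_A by (simp add: fibA_def)

lemma finite_fibY: "finite (fibY k w)"
  using finite_Y by (simp add: fibY_def)

lemma finite_funs: "finite (funs \<Phi> k v w)"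
proof (rule finite_subset)
  show "funs \<Phi> k v w \<subseteq> fibA k v \<rightarrow>\<^sub>E fibY k w"
    by (auto simp: funs_def)
qed (simp add: finite_PiE finite_fibA finite_fibY)

lemma fibA_child: "v' \<in> pA (Suc k) ` fibA k v \<Longrightarrow> fibA (Suc k) v' \<subseteq> fibA k v"
proof
  fix b assume "v' \<in> pA (Suc k) ` fibA k v" "b \<in> fibA (Suc k) v'"
  then obtain a where "b \<in> A" "pA k a = v" "pA (Suc k) b = pA (Suc k) a"
    unfolding fibA_def by blast
  then show "b \<in> fibA k v"
    using pA_mono[of "Suc k" b a k] by (simp add: fibA_def)
qed

lemma fibY_child: "w' \<in> pY (Suc k) ` fibY k w \<Longrightarrow> fibY (Suc k) w' \<subseteq> fibY k w"
proof
  fix b assume "w' \<in> pY (Suc k) ` fibY k w" "b \<in> fibY (Suc k) w'"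
  then obtain a where "b \<in> Y" "pY k a = w" "pY (Suc k) b = pY (Suc k) a"
    unfolding fibY_def by blast
  then show "b \<in> fibY k w"
    using pY_mono[of "Suc k" b a k] by (simp add: fibY_def)
qed

text \<open>Pieces chosen independently below the children always glue. Leaves below different
  children can share an ancestor only at levels up to \<open>k\<close>, and there their labels agree
  because both lie below \<open>w\<close>; at deeper levels compatibility concerns a single piece.
  The union over \<open>w'\<close> is the choice of a label for the child.\<close>

lemma funs_bij_children:
  assumes k: "k < n"
  shows "bij_betw (\<lambda>g. \<lambda>v'\<in>pA (Suc k) ` fibA k v. restrict g (fibA (Suc k) v'))
    (funs \<Phi> k v w)
    (\<Pi>\<^sub>E v'\<in>pA (Suc k) ` fibA k v. \<Union>w'\<in>pY (Suc k) ` fibY k w. funs \<Phi> (Suc k) v' w')"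
    (is "bij_betw ?r ?F ?G")
proof (rule bij_betw_byWitness[where f' = "\<lambda>h. \<lambda>a\<in>fibA k v. h (pA (Suc k) a) a"])
  let ?V = "pA (Suc k) ` fibA k v" and ?W = "pY (Suc k) ` fibY k w"
  let ?s = "\<lambda>h. \<lambda>a\<in>fibA k v. h (pA (Suc k) a) a"
  have self: "a \<in> fibA (Suc k) (pA (Suc k) a)" if "a \<in> fibA k v" for a
    using that by (auto simp: fibA_def)
  show "\<forall>g\<in>?F. ?s (?r g) = g"
  proof
    fix g assume "g \<in> ?F"
    then have "g \<in> extensional (fibA k v)"
      by (auto simp: funs_def PiE_def)
    then show "?s (?r g) = g"
      using self by (auto simp: fun_eq_iff extensional_def)
  qed
  show "\<forall>h\<in>?G. ?r (?s h) = h"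
  proof
    fix h assume h: "h \<in> ?G"
    show "?r (?s h) = h"
    proof
      fix v'
      show "?r (?s h) v' = h v'"
      proof (cases "v' \<in> ?V")
        case True
        then obtain w' where "h v' \<in> funs \<Phi> (Suc k) v' w'"
          using h by (auto simp: PiE_iff)
        then have "h v' \<in> extensional (fibA (Suc k) v')"
          by (auto simp: funs_def PiE_def)
        moreover have "pA (Suc k) a = v'" "a \<in> fibA k v" if "a \<in> fibA (Suc k) v'" for a
          using that fibA_child[OF True] by (auto simp: fibA_def)
        ultimately have "?r (?s h) v' b = h v' b" for b
          using True by (cases "b \<in> fibA (Suc k) v'") (simp_all add: extensional_def)
        then show ?thesis ..
      next
        case False
        then show ?thesis
          using h by (auto simp: PiE_iff extensional_def)
      qed
    qed
  qed
  show "?r ` ?F \<subseteq> ?G"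
  proof clarify
    fix g assume g: "g \<in> ?F"
    show "?r g \<in> ?G"
    proof (intro PiE_I)
      fix v' assume v': "v' \<in> ?V"
      then obtain a where a: "a \<in> fibA k v" "v' = pA (Suc k) a"
        by auto
      let ?w = "pY (Suc k) (g a)"
      have sub: "fibA (Suc k) v' \<subseteq> fibA k v"
        using v' by (rule fibA_child)
      have "restrict g (fibA (Suc k) v') \<in> funs \<Phi> (Suc k) v' ?w"
      proof -
        have "g b \<in> fibY (Suc k) ?w" if "b \<in> fibA (Suc k) v'" for b
        proof -
          have b: "b \<in> fibA k v" "pA (Suc k) b = pA (Suc k) a"
            using that sub a by (auto simp: fibA_def)
          have "pY (Suc k) (g b) = ?w"
            using funsD(3)[OF g b(1) _ a(1) b(2)] k by simp
          moreover have "g b \<in> Y"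
            using funsD(1)[OF g b(1)] by (simp add: fibY_def)
          ultimately show ?thesis
            by (auto simp: fibY_def)
        qed
        moreover have "compat (fibA (Suc k) v') (restrict g (fibA (Suc k) v'))"
          unfolding compat_def
        proof (intro allI impI ballI)
          fix j b c
          assume "j \<le> n" "b \<in> fibA (Suc k) v'" "c \<in> fibA (Suc k) v'" "pA j b = pA j c"
          then show "pY j (restrict g (fibA (Suc k) v') b) = pY j (restrict g (fibA (Suc k) v') c)"
            using funsD(3)[OF g, of b j c] sub by auto
        qed
        moreover have "\<Phi> b (g b)" if "b \<in> fibA (Suc k) v'" for b
          using funsD(2)[OF g, of b] sub that by blast
        ultimately show ?thesis
          by (auto simp: funs_def)
      qed
      moreover have "?w \<in> ?W"
        using funsD(1)[OF g a(1)] by (rule imageI)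
      moreover have "?r g v' = restrict g (fibA (Suc k) v')"
        using v' by simp
      ultimately show "?r g v' \<in> (\<Union>w'\<in>?W. funs \<Phi> (Suc k) v' w')"
        by (metis UN_I)
    qed auto
  qed
  show "?s ` ?G \<subseteq> ?F"
  proof clarify
    fix h assume h: "h \<in> ?G"
    let ?g = "?s h"
    have hv: "\<exists>w'\<in>?W. h v' \<in> funs \<Phi> (Suc k) v' w'" if "v' \<in> ?V" for v'
      using h that by (auto simp: PiE_iff)
    have val: "?g a \<in> fibY k w" "\<Phi> a (?g a)" if a: "a \<in> fibA k v" for a
    proof -
      obtain w' where w': "w' \<in> ?W" "h (pA (Suc k) a) \<in> funs \<Phi> (Suc k) (pA (Suc k) a) w'"
        using hv a by blast
      have m: "?g a = h (pA (Suc k) a) a" "h (pA (Suc k) a) a \<in> fibY (Suc k) w'"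
        using funsD(1)[OF w'(2) self[OF a]] a by simp_all
      show "\<Phi> a (?g a)"
        using funsD(2)[OF w'(2) self[OF a]] a by simp
      show "?g a \<in> fibY k w"
        using m fibY_child[OF w'(1)] by auto
    qed
    have "compat (fibA k v) ?g"
      unfolding compat_def
    proof (intro allI impI ballI)
      fix j a b
      assume j: "j \<le> n" and a: "a \<in> fibA k v" and b: "b \<in> fibA k v" and ab: "pA j a = pA j b"
      show "pY j (?g a) = pY j (?g b)"
      proof (cases "j \<le> k")
        case True
        have "pY k (?g a) = pY k (?g b)"
          using val(1)[OF a] val(1)[OF b] by (simp only: fibY_def mem_Collect_eq)
        then show ?thesis
          using True by (rule pY_mono)
      next
        case False
        then have eq: "pA (Suc k) b = pA (Suc k) a"
          using pA_mono[OF ab[symmetric], of "Suc k"] by simp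
        obtain w' where "h (pA (Suc k) a) \<in> funs \<Phi> (Suc k) (pA (Suc k) a) w'"
          using hv a by blast
        then have "pY j (h (pA (Suc k) a) a) = pY j (h (pA (Suc k) a) b)"
          using self[OF a] j self[OF b, unfolded eq] ab by (rule funsD(3))
        then show ?thesis
          using a b eq by simp
      qed
    qed
    then show "?g \<in> ?F"
      using val by (auto simp: funs_def)
  qed
qed

text \<open>Every child \<open>v'\<close> has a leaf below it, and the label of that leaf determines
  \<open>w'\<close>. Hence the union over \<open>w'\<close> is disjoint and its cardinality is a
  sum.\<close>

lemma card_funs_children:
  assumes k: "k < n"
  shows "card (funs \<Phi> k v w) =
    (\<Prod>v'\<in>pA (Suc k) ` fibA k v. \<Sum>w'\<in>pY (Suc k) ` fibY k w. card (funs \<Phi> (Suc k) v' w'))"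
proof -
  let ?V = "pA (Suc k) ` fibA k v" and ?W = "pY (Suc k) ` fibY k w"
  have "card (funs \<Phi> k v w) = card (\<Pi>\<^sub>E v'\<in>?V. \<Union>w'\<in>?W. funs \<Phi> (Suc k) v' w')"
    using funs_bij_children[OF k] by (rule bij_betw_same_card)
  also have "\<dots> = (\<Prod>v'\<in>?V. card (\<Union>w'\<in>?W. funs \<Phi> (Suc k) v' w'))"
    by (simp add: card_PiE finite_fibA)
  also have "\<dots> = (\<Prod>v'\<in>?V. \<Sum>w'\<in>?W. card (funs \<Phi> (Suc k) v' w'))"
  proof (rule prod.cong[OF refl], rule card_UN_disjoint)
    fix v' assume "v' \<in> ?V"
    then obtain a where a: "a \<in> fibA (Suc k) v'"
      by (auto simp: fibA_def)
    have "g a \<in> fibY (Suc k) w'" if "g \<in> funs \<Phi> (Suc k) v' w'" for g w'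
      using that a by (auto simp: funs_def)
    then have "w1 = w2"
      if "g \<in> funs \<Phi> (Suc k) v' w1" "g \<in> funs \<Phi> (Suc k) v' w2" for g w1 w2
      using that unfolding fibY_def by blast
    then show "\<forall>w1\<in>?W. \<forall>w2\<in>?W. w1 \<noteq> w2 \<longrightarrow>
        funs \<Phi> (Suc k) v' w1 \<inter> funs \<Phi> (Suc k) v' w2 = {}"
      by blast
  qed (simp_all add: finite_fibY finite_funs)
  finally show ?thesis .
qed

lemma card_funs_leaf:
  assumes a: "a \<in> A" and y: "y \<in> Y"
  shows "card (funs \<Phi> n (pA n a) (pY n y)) = (if \<Phi> a y then 1 else 0)"
proof -
  have "fibA n (pA n a) = {a}" "fibY n (pY n y) = {y}"
    using a y inj_pA inj_pY by (auto simp: fibA_def fibY_def inj_on_def)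
  moreover have "compat {a} g" for g
    by (auto simp: compat_def)
  ultimately have "funs \<Phi> n (pA n a) (pY n y) = {g \<in> {a} \<rightarrow>\<^sub>E {y}. \<Phi> a (g a)}"
    by (simp add: funs_def)
  also have "\<dots> = {g \<in> {a} \<rightarrow>\<^sub>E {y}. \<Phi> a y}"
    by (rule Collect_cong) (auto simp: PiE_iff)
  finally show ?thesis
    by (simp add: PiE_singleton card_PiE)
qed

end

text \<open>
  The vertices \<open>a\<close> with \<open>G k a (g a)\<close> form a Galton--Watson process when \<open>g\<close> is uniformly
  distributed: a surviving vertex has \<open>Q\<close> children, each surviving with probability \<open>1 / Q\<close>
  independently of the others.
\<close>

locale galton_watson = level_functions A Y n pA pY
  for A :: "'a set" and Y :: "'b set" and n :: nat
    and pA :: "nat \<Rightarrow> 'a \<Rightarrow> 'c" and pY :: "nat \<Rightarrow> 'b \<Rightarrow> 'e" +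
  fixes G :: "nat \<Rightarrow> 'a \<Rightarrow> 'b \<Rightarrow> bool" and Q s :: nat and u :: "nat \<Rightarrow> real"
  assumes G_cong: "\<And>k a a' y y'.
      \<lbrakk>a \<in> A; a' \<in> A; y \<in> Y; y' \<in> Y; pA k a = pA k a'; pY k y = pY k y'; G k a y\<rbrakk> \<Longrightarrow> G k a' y'"
    and G_Suc: "\<And>k a y. \<lbrakk>a \<in> A; y \<in> Y; G (Suc k) a y\<rbrakk> \<Longrightarrow> G k a y"
    and card_children_Y: "\<And>k y. \<lbrakk>k < n; y \<in> Y\<rbrakk> \<Longrightarrow> card (pY (Suc k) ` fibY k (pY k y)) = s * Q"
    and card_good: "\<And>k a y. \<lbrakk>k < n; a \<in> A; y \<in> Y; G k a y\<rbrakk> \<Longrightarrow>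
      card (pY (Suc k) ` {y' \<in> fibY k (pY k y). G (Suc k) a y'}) = s"
    and card_children_A: "\<And>k a. \<lbrakk>0 < k; k < n; a \<in> A\<rbrakk> \<Longrightarrow> card (pA (Suc k) ` fibA k (pA k a)) = Q"
    and sQ: "0 < s" "0 < Q"
    and u_0: "u 0 = 1"
    and u_Suc: "\<And>m. u (Suc m) = 1 - (1 - u m / real Q) ^ Q"
begin

text \<open>Number of all labellings below a labelled vertex other than the root that is
  \<open>m\<close> levels above the leaves: each of its \<open>Q\<close> children receives one of
  \<open>s * Q\<close> labels and then one of \<open>total m\<close> labellings below.\<close>

fun total :: "nat \<Rightarrow> nat" where
  "total 0 = 1"
| "total (Suc m) = (s * Q * total m) ^ Q"

text \<open>The exponent is kept as the actual number of children, so that the same step also serves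
  the root, where it differs from \<open>Q\<close>.\<close>

lemma card_all_step:
  assumes k: "k < n" and a: "a \<in> A" and y: "y \<in> Y"
    and IH: "\<And>b z. \<lbrakk>b \<in> A; z \<in> Y\<rbrakk> \<Longrightarrow>
      card (funs (\<lambda>_ _. True) (Suc k) (pA (Suc k) b) (pY (Suc k) z)) = N"
  shows "card (funs (\<lambda>_ _. True) k (pA k a) (pY k y)) = (s * Q * N) ^ card (pA (Suc k) ` fibA k (pA k a))"
proof -
  have "card (funs (\<lambda>_ _. True) (Suc k) v' w') = N"
    if "v' \<in> pA (Suc k) ` fibA k (pA k a)" "w' \<in> pY (Suc k) ` fibY k (pY k y)" for v' w'
    using that IH by (auto simp: fibA_def fibY_def)
  then show ?thesis
    by (simp add: card_funs_children[OF k] card_children_Y[OF k y])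
qed

text \<open>Below a surviving vertex, \<open>s\<close> of the \<open>s * Q\<close> labels of a child
  survive, and each of these loses the fraction \<open>x\<close> of its \<open>N\<close> labellings;
  what remains is \<open>s * Q * N - s * x * N\<close>. Below a dead vertex every label is dead by
  \<open>G_Suc\<close>, so nothing is lost.\<close>

lemma card_bad_step:
  assumes k: "k < n" and a: "a \<in> A" and y: "y \<in> Y"
    and IH: "\<And>b z. \<lbrakk>b \<in> A; z \<in> Y\<rbrakk> \<Longrightarrow>
      real (card (funs (\<lambda>b z. \<not> G n b z) (Suc k) (pA (Suc k) b) (pY (Suc k) z))) =
      (if G (Suc k) b z then (1 - x) * N else N)"
  shows "real (card (funs (\<lambda>b z. \<not> G n b z) k (pA k a) (pY k y))) =
    (if G k a y then (1 - x / real Q) * (s * Q * N) else s * Q * N)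
      ^ card (pA (Suc k) ` fibA k (pA k a))"
proof -
  let ?W = "pY (Suc k) ` fibY k (pY k y)"
  let ?c = "\<lambda>v' w'. real (card (funs (\<lambda>b z. \<not> G n b z) (Suc k) v' w'))"
  have "(\<Sum>w'\<in>?W. ?c v' w') = (if G k a y then (1 - x / real Q) * (s * Q * N) else s * Q * N)"
    if v': "v' \<in> pA (Suc k) ` fibA k (pA k a)" for v'
  proof -
    obtain b where b: "b \<in> A" "pA k b = pA k a" "v' = pA (Suc k) b"
      using v' by (auto simp: fibA_def)
    \<comment> \<open>The surviving labels of the child. By \<open>G_cong\<close> survival depends
      on the label only, so membership in this set can be tested on any representative
      \<open>z\<close>.\<close>
    let ?W1 = "pY (Suc k) ` {z \<in> fibY k (pY k y). G (Suc k) b z}"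
    have W1: "?W1 \<subseteq> ?W" and fin: "finite ?W" "finite ?W1"
      using finite_fibY by auto
    have c: "?c v' w' = N - (if w' \<in> ?W1 then x * N else 0)" if "w' \<in> ?W" for w'
    proof -
      obtain z where z: "z \<in> fibY k (pY k y)" "w' = pY (Suc k) z"
        using \<open>w' \<in> ?W\<close> by blast
      have "w' \<in> ?W1 \<longleftrightarrow> G (Suc k) b z"
        using z b G_cong[of b b _ z "Suc k"] by (auto simp: fibY_def)
      then show ?thesis
        using IH[of b z] z b by (auto simp: fibY_def algebra_simps)
    qed
    have "(\<Sum>w'\<in>?W. ?c v' w') = (\<Sum>w'\<in>?W. N - (if w' \<in> ?W1 then x * N else 0))"
      using c by (intro sum.cong) auto
    also have "\<dots> = real (card ?W) * N - real (card (?W \<inter> ?W1)) * (x * N)"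
      using fin by (simp add: sum_subtractf sum.inter_restrict[symmetric])
    also have "?W \<inter> ?W1 = ?W1"
      using W1 by blast
    finally have sum: "(\<Sum>w'\<in>?W. ?c v' w') = s * Q * N - real (card ?W1) * (x * N)"
      by (simp add: card_children_Y[OF k y])
    show ?thesis
    proof (cases "G k a y")
      case True
      then have "G k b y"
        using G_cong[of a b y y k] a b y by simp
      then have "card ?W1 = s"
        using card_good[OF k b(1) y] by simp
      moreover have "(1 - x / real Q) * (s * Q * N) = s * Q * N - s * (x * N)"
        using sQ by (simp add: field_simps)
      ultimately show ?thesis
        using sum True by simp
    next
      case False
      have "\<not> G (Suc k) b z" if z: "z \<in> fibY k (pY k y)" for z
      proof
        assume "G (Suc k) b z"
        then have "G k b z"
          using G_Suc b z by (auto simp: fibY_def)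
        then show False
          using False G_cong[of b a z y k] a b y z by (auto simp: fibY_def)
      qed
      then have "?W1 = {}"
        by blast
      then have "card ?W1 = 0"
        by (metis card.empty)
      then show ?thesis
        using sum False by simp
    qed
  qed
  then show ?thesis
    by (simp add: card_funs_children[OF k])
qed

text \<open>The bound \<open>m < n\<close> keeps the level \<open>n - m\<close> positive, where
  vertices have \<open>Q\<close> children; the root is left to \<open>bad_ratio\<close>.\<close>

lemma card_all:
  assumes "m < n" "a \<in> A" "y \<in> Y"
  shows "card (funs (\<lambda>_ _. True) (n - m) (pA (n - m) a) (pY (n - m) y)) = total m"
  using assms
proof (induction m arbitrary: a y)
  case 0
  then show ?case
    using card_funs_leaf[of a y "\<lambda>_ _. True"] by simp
next
  case (Suc m)
  define k where "k = n - Suc m"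
  then have k: "n - m = Suc k" "n - Suc m = k" "0 < k" "k < n" "m < n"
    using Suc.prems by auto
  have "card (funs (\<lambda>_ _. True) (Suc k) (pA (Suc k) b) (pY (Suc k) z)) = total m"
    if "b \<in> A" "z \<in> Y" for b z
    using Suc.IH[unfolded k(1)] that k(5) by blast
  from card_all_step[OF k(4) Suc.prems(2,3) this] show ?case
    unfolding k(2) card_children_A[OF k(3,4) Suc.prems(2)] total.simps .
qed

text \<open>The recursion for \<open>u\<close> says that \<open>1 - u (Suc m)\<close> is the
  \<open>Q\<close>-th power of the factor \<open>1 - u m / Q\<close> contributed by one child in
  \<open>card_bad_step\<close>.\<close>

lemma card_bad:
  assumes "m < n" "a \<in> A" "y \<in> Y"
  shows "real (card (funs (\<lambda>b z. \<not> G n b z) (n - m) (pA (n - m) a) (pY (n - m) y))) =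
    (if G (n - m) a y then (1 - u m) * total m else total m)"
  using assms
proof (induction m arbitrary: a y)
  case 0
  then show ?case
    using card_funs_leaf[of a y "\<lambda>b z. \<not> G n b z"] by (simp add: u_0)
next
  case (Suc m)
  define k where "k = n - Suc m"
  then have k: "n - m = Suc k" "n - Suc m = k" "0 < k" "k < n" "m < n"
    using Suc.prems by auto
  have "real (card (funs (\<lambda>b z. \<not> G n b z) (Suc k) (pA (Suc k) b) (pY (Suc k) z))) =
      (if G (Suc k) b z then (1 - u m) * total m else total m)"
    if "b \<in> A" "z \<in> Y" for b z
    using Suc.IH[unfolded k(1)] that k(5) by blast
  from card_bad_step[OF k(4) Suc.prems(2,3) this] show ?case
    unfolding k(2) card_children_A[OF k(3,4) Suc.prems(2)] total.simps u_Suc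
    by (simp add: power_mult_distrib)
qed

text \<open>The last step of the recursion, taken at the root: the children have level 1, that is
  \<open>m = n - 1\<close>, and their number stays in the exponent.\<close>

lemma bad_ratio:
  assumes n: "0 < n" and a: "a \<in> A" and y: "y \<in> Y" and G0: "G 0 a y"
  shows "real (card (funs (\<lambda>b z. \<not> G n b z) 0 (pA 0 a) (pY 0 y))) =
    (1 - u (n - 1) / real Q) ^ card (pA 1 ` fibA 0 (pA 0 a))
      * real (card (funs (\<lambda>_ _. True) 0 (pA 0 a) (pY 0 y)))"
proof -
  have S: "n - (n - 1) = Suc 0" and less: "n - 1 < n"
    using n by auto
  have "card (funs (\<lambda>_ _. True) (Suc 0) (pA (Suc 0) b) (pY (Suc 0) z)) = total (n - 1)"
    if "b \<in> A" "z \<in> Y" for b z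
    using card_all[OF less that] unfolding S .
  note all = card_all_step[OF n a y this]
  have "real (card (funs (\<lambda>b z. \<not> G n b z) (Suc 0) (pA (Suc 0) b) (pY (Suc 0) z))) =
      (if G (Suc 0) b z then (1 - u (n - 1)) * total (n - 1) else total (n - 1))"
    if "b \<in> A" "z \<in> Y" for b z
    using card_bad[OF less that] unfolding S .
  note bad = card_bad_step[OF n a y this]
  show ?thesis
    using bad G0 by (simp add: all[unfolded One_nat_def] power_mult_distrib)
qed

end


section \<open>Congruences modulo powers of the uniformizer\<close>

lemma card_vec_boxes:
  fixes S :: "'d::finite \<Rightarrow> 'a set"
  shows "card {x :: 'a ^ 'd. \<forall>i. x $ i \<in> S i} = (\<Prod>i\<in>UNIV. card (S i))"
proof -
  have "bij_betw vec_nth {x :: 'a ^ 'd. \<forall>i. x $ i \<in> S i} (Pi\<^sub>E UNIV S)"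
    by (rule bij_betw_byWitness[where f' = vec_lambda]) auto
  then show ?thesis
    by (simp add: bij_betw_same_card card_PiE)
qed

text \<open>The number of elements above \<open>j\<close> is strictly decreasing in
  \<open>j\<close>, hence takes each value below \<open>CARD('d)\<close> once. This turns a sum over
  pivot positions into a geometric sum.\<close>

lemma sum_card_greater:
  fixes h :: "nat \<Rightarrow> 'b::comm_monoid_add"
  shows "(\<Sum>j\<in>(UNIV :: 'd::{finite,linorder} set). h (card {i. j < i})) = (\<Sum>m<CARD('d). h m)"
proof -
  let ?f = "\<lambda>j :: 'd. card {i. j < i}"
  have less: "?f j' < ?f j" if "j < j'" for j j'
    using that by (intro psubset_card_mono) auto
  have inj: "inj ?f"
  proof (rule injI)
    fix x y :: 'd assume "?f x = ?f y"
    then show "x = y"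
      using less[of x y] less[of y x] by (cases x y rule: linorder_cases) auto
  qed
  have "?f j < CARD('d)" for j
    by (intro psubset_card_mono) auto
  then have "range ?f = {..<CARD('d)}"
    using inj by (intro card_subset_eq) (auto simp: card_image)
  then show ?thesis
    using sum.reindex[OF inj, of h] by (simp add: comp_def)
qed

context complete_dvf
begin

section \<open>Absolute value, divisibility by powers of the uniformizer, residue digits\<close>

lemma q_pos: "0 < real q" "1 < real q"
  using q_gt_1 by auto

lemma val_power: "val (\<pi> ^ k) = int k"
  by (induction k) (auto simp: val_one val_mult uniformizer_nonzero val_uniformizer)

lemma absv_pi_power: "absv (\<pi> ^ k) = 1 / real q ^ k"
  by (simp add: absv_def uniformizer_nonzero val_power power_int_minus inverse_eq_divide)

lemma absv_le_iff_val: "x \<noteq> 0 \<Longrightarrow> absv x \<le> 1 / real q ^ k \<longleftrightarrow> int k \<le> val x"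
proof -
  assume x: "x \<noteq> 0"
  have "1 / real q ^ k = real q powi (- int k)"
    by (simp add: power_int_minus inverse_eq_divide)
  then show ?thesis
    using x q_pos power_int_increasing[of "- val x" "- int k" "real q"]
      power_int_strict_increasing[of "- int k" "- val x" "real q"]
    by (auto simp: absv_def not_le[symmetric])
qed

lemma R_iff: "x \<in> R \<longleftrightarrow> absv x \<le> 1"
  using absv_le_iff_val[of x 0] by (cases "x = 0") (auto simp: R_def absv_def)

text \<open>Discreteness: no absolute value lies strictly between 1/q and 1. Strict inequalities
  thereby become congruences modulo \<pi>.\<close>

lemma absv_less_1_iff: "absv x < 1 \<longleftrightarrow> absv x \<le> 1 / real q"
proof (cases "x = 0")
  case False
  have "1 / real q < 1"
    using q_pos by simp
  moreover have "absv x \<le> 1 / real q" if "absv x < 1"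
  proof -
    have "absv x = real q powi (- val x)"
      using False by (simp add: absv_def)
    moreover have "real q powi 0 \<le> real q powi (- val x)" if "\<not> 0 < val x"
      using that q_pos by (intro power_int_increasing) auto
    ultimately have "0 < val x"
      using \<open>absv x < 1\<close> by fastforce
    then show ?thesis
      using absv_le_iff_val[OF False, of 1] by simp
  qed
  ultimately show ?thesis
    by linarith
qed (use q_pos in \<open>auto simp: absv_def\<close>)

lemma R_absv_cases:
  assumes "x \<in> R"
  obtains "x = 0" | j where "absv x = 1 / real q ^ j"
proof (cases "x = 0")
  case False
  then have "val x = int (nat (val x))"
    using assms by (simp add: R_def)
  then have "absv x = real q powi (- int (nat (val x)))"
    using False by (simp add: absv_def)
  then have "absv x = 1 / real q ^ nat (val x)"
    by (simp only: power_int_minus inverse_eq_divide power_int_of_nat)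
  then show ?thesis
    using that by blast
qed (use that in blast)

lemma absv_le_power_iff: "absv x \<le> 1 / real q ^ k \<longleftrightarrow> (\<exists>r\<in>R. x = \<pi> ^ k * r)"
proof
  assume "absv x \<le> 1 / real q ^ k"
  moreover have "x = \<pi> ^ k * (x / \<pi> ^ k)"
    by (simp add: uniformizer_nonzero)
  then have "absv x = 1 / real q ^ k * absv (x / \<pi> ^ k)"
    by (metis absv_mult absv_pi_power)
  ultimately have "absv (x / \<pi> ^ k) \<le> 1"
    using q_pos by (simp add: field_simps)
  then show "\<exists>r\<in>R. x = \<pi> ^ k * r"
    using \<open>x = \<pi> ^ k * (x / \<pi> ^ k)\<close> R_iff by blast
next
  assume "\<exists>r\<in>R. x = \<pi> ^ k * r"
  then obtain r where "absv r \<le> 1" "x = \<pi> ^ k * r"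
    by (auto simp: R_iff)
  then show "absv x \<le> 1 / real q ^ k"
    using q_pos by (simp add: absv_mult absv_pi_power field_simps)
qed

lemma \<mm>_iff: "x \<in> \<mm> \<longleftrightarrow> absv x < 1"
  unfolding absv_less_1_iff using absv_le_power_iff[of x 1] by (auto simp: \<mm>_def)

lemma absv_diff: "absv (x - y) \<le> max (absv x) (absv y)"
  using absv_add[of x "- y"] by (simp add: absv_minus)

lemma absv_diff_commute: "absv (x - y) = absv (y - x)"
  using absv_minus[of "x - y"] by simp

lemma R_simps: "0 \<in> R" "1 \<in> R"
  and R_add: "\<lbrakk>x \<in> R; y \<in> R\<rbrakk> \<Longrightarrow> x + y \<in> R"
  and R_diff: "\<lbrakk>x \<in> R; y \<in> R\<rbrakk> \<Longrightarrow> x - y \<in> R"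
  and R_mult: "\<lbrakk>x \<in> R; y \<in> R\<rbrakk> \<Longrightarrow> x * y \<in> R"
  and R_minus: "x \<in> R \<Longrightarrow> - x \<in> R"
  using absv_add[of x y] absv_diff[of x y] mult_mono[of "absv x" 1 "absv y" 1] absv_nonneg[of y]
  by (auto simp: R_iff absv_one absv_mult absv_minus absv_eq_0[THEN iffD2])

lemma pi_power_R: "\<pi> ^ k \<in> R"
  using q_pos by (simp add: R_iff absv_pi_power)

text \<open>Representatives of the residue field inside \<open>R\<close>. The classes at level
  \<open>k + 1\<close> within the class of \<open>y\<close> at level \<open>k\<close> will be
  enumerated by \<open>y + \<pi> ^ k *s e\<close> with entries of \<open>e\<close> taken from
  \<open>D\<close>.\<close>

definition digits :: "'k set \<Rightarrow> bool" where
  "digits D \<longleftrightarrow> D \<subseteq> R \<and> finite D \<and> card D = q \<and>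
    (\<forall>x\<in>R. \<exists>d\<in>D. absv (x - d) < 1) \<and> (\<forall>d\<in>D. \<forall>d'\<in>D. absv (d - d') < 1 \<longrightarrow> d = d')"

lemma ex_digits: "\<exists>D. digits D"
proof -
  define r where "r = {(x, y). x \<in> R \<and> y \<in> R \<and> x - y \<in> \<mm>}"
  have r: "equiv R r"
  proof (rule equivI)
    show "r \<subseteq> R \<times> R"
      by (auto simp: r_def)
    show "refl_on R r"
      by (rule refl_onI) (auto simp: r_def \<mm>_iff absv_eq_0[THEN iffD2])
    show "sym r"
      by (rule symI) (auto simp: r_def \<mm>_iff absv_diff_commute)
    show "trans r"
    proof (rule transI)
      fix x y z assume "(x, y) \<in> r" "(y, z) \<in> r"
      then show "(x, z) \<in> r"
        using absv_add[of "x - y" "y - z"] by (auto simp: r_def \<mm>_iff)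
    qed
  qed
  have "residue_field \<subseteq> (\<lambda>x. r `` {x}) ` R"
    by (auto simp: residue_field_def r_def quotient_def)
  then obtain D where D: "D \<subseteq> R" "inj_on (\<lambda>x. r `` {x}) D" "residue_field = (\<lambda>x. r `` {x}) ` D"
    by (auto simp: subset_image_inj)
  have "\<exists>d\<in>D. absv (x - d) < 1" if x: "x \<in> R" for x
  proof -
    have "r `` {x} \<in> residue_field"
      unfolding residue_field_def r_def[symmetric] using x by (rule quotientI)
    then obtain d where d: "d \<in> D" "r `` {x} = r `` {d}"
      using D(3) by auto
    then have "(x, d) \<in> r"
      using eq_equiv_class_iff[OF r x, of d] D(1) by auto
    then show ?thesis
      using d by (auto simp: r_def \<mm>_iff)
  qed
  moreover have "d = d'" if "d \<in> D" "d' \<in> D" "absv (d - d') < 1" for d d'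
  proof -
    have "(d, d') \<in> r"
      using that D(1) by (auto simp: r_def \<mm>_iff)
    then show ?thesis
      using that D(2) equiv_class_eq[OF r] by (auto simp: inj_on_def)
  qed
  moreover have "finite D" "card D = q"
    using D finite_residue_field finite_image_iff[OF D(2)] card_image[OF D(2)] by (auto simp: q_def)
  ultimately show ?thesis
    using D(1) by (auto simp: digits_def)
qed

section \<open>The sup norm and residue classes of vectors\<close>

lemma supnorm_diff: "supnorm (x - y) \<le> max (supnorm x) (supnorm y)"
  using supnorm_add[of x "- y"] by (simp add: supnorm_minus)

lemma supnorm_commute: "supnorm (x - y) = supnorm (y - x)"
  using supnorm_minus[of "x - y"] by simp

lemma supnorm_ultra: "\<lbrakk>supnorm (x - y) \<le> c; supnorm (y - z) \<le> c\<rbrakk> \<Longrightarrow> supnorm (x - z) \<le> c"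
  using supnorm_add[of "x - y" "y - z"] by simp

lemma Rd_iff: "x \<in> Rd \<longleftrightarrow> supnorm x \<le> 1"
  by (simp add: Rd_def R_iff supnorm_le_iff)

lemma Rd_add: "\<lbrakk>x \<in> Rd; y \<in> Rd\<rbrakk> \<Longrightarrow> x + y \<in> Rd"
  and Rd_diff: "\<lbrakk>x \<in> Rd; y \<in> Rd\<rbrakk> \<Longrightarrow> x - y \<in> Rd"
  and Rd_scale: "\<lbrakk>t \<in> R; x \<in> Rd\<rbrakk> \<Longrightarrow> t *s x \<in> Rd"
  and Rd_0: "0 \<in> Rd"
  by (auto simp: Rd_def R_simps R_add R_diff R_mult)

lemma Rd_minus: "x \<in> Rd \<Longrightarrow> - x \<in> Rd"
  by (simp add: Rd_iff supnorm_minus)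

lemma Rd_supnorm_cases:
  assumes "x \<in> Rd"
  obtains "x = 0" | j where "supnorm x = 1 / real q ^ j"
proof -
  obtain i where i: "supnorm x = absv (x $ i)"
    using supnorm_attained by blast
  have "x $ i \<in> R"
    using assms by (simp add: Rd_def)
  then show ?thesis
    using that i supnorm_eq_0[of x] absv_eq_0[of "x $ i"] by (elim R_absv_cases) auto
qed

lemma supnorm_power_iff: "supnorm x \<le> 1 / real q ^ k \<longleftrightarrow> (\<exists>r\<in>Rd. x = \<pi> ^ k *s r)"
proof
  assume "supnorm x \<le> 1 / real q ^ k"
  then have "\<exists>r. r \<in> R \<and> x $ i = \<pi> ^ k * r" for i
    by (auto simp: supnorm_le_iff absv_le_power_iff)
  then obtain r where "\<And>i. r i \<in> R \<and> x $ i = \<pi> ^ k * r i"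
    by metis
  then show "\<exists>r\<in>Rd. x = \<pi> ^ k *s r"
    by (intro bexI[of _ "\<chi> i. r i"]) (auto simp: Rd_def vec_eq_iff)
next
  assume "\<exists>r\<in>Rd. x = \<pi> ^ k *s r"
  then show "supnorm x \<le> 1 / real q ^ k"
    by (auto simp: supnorm_le_iff absv_le_power_iff Rd_def)
qed

text \<open>The residue class of \<open>x\<close> modulo \<open>\<pi> ^ k\<close>, encoded as a
  ball; in the ultrametric setting equality of balls is the congruence. These maps become the
  ancestor maps \<open>pA\<close> and \<open>pY\<close> of both trees.\<close>

definition cl :: "nat \<Rightarrow> 'k ^ 'd::finite \<Rightarrow> ('k ^ 'd) set" where
  "cl k x = {z. supnorm (z - x) \<le> 1 / real q ^ k}"

lemma inverse_power_mono: "j \<le> k \<Longrightarrow> 1 / real q ^ k \<le> 1 / real q ^ j"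
  using q_pos by (intro divide_left_mono power_increasing mult_pos_pos) auto

lemma cl_self: "x \<in> cl k x"
  using q_pos by (simp add: cl_def supnorm_eq_0[THEN iffD2])

lemma cl_eq_iff: "cl k x = cl k y \<longleftrightarrow> supnorm (x - y) \<le> 1 / real q ^ k"
proof
  assume "cl k x = cl k y"
  then show "supnorm (x - y) \<le> 1 / real q ^ k"
    using cl_self[of x k] by (simp add: cl_def)
next
  assume "supnorm (x - y) \<le> 1 / real q ^ k"
  then show "cl k x = cl k y"
    using supnorm_ultra[of _ x _ y] supnorm_ultra[of _ y _ x] supnorm_commute[of x y]
    by (auto simp: cl_def)
qed

lemma cl_mono: "\<lbrakk>cl k x = cl k y; j \<le> k\<rbrakk> \<Longrightarrow> cl j x = cl j y"
  using inverse_power_mono[of j k] by (simp add: cl_eq_iff)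

lemma cl_0: "\<lbrakk>x \<in> Rd; y \<in> Rd\<rbrakk> \<Longrightarrow> cl 0 x = cl 0 y"
  using Rd_diff[of x y] by (simp add: cl_eq_iff Rd_iff)

text \<open>Two digits congruent modulo \<pi> are equal. A coordinate may also be frozen to a
  constant outside \<open>D\<close>: canonical vectors need prescribed entries 0 and 1
  there.\<close>

lemma digit_vec_inj:
  assumes D: "digits D" and S: "\<And>i. S i \<subseteq> D \<or> (\<exists>c. S i = {c})"
  shows "inj_on (\<lambda>e. cl (Suc k) (y + \<pi> ^ k *s e)) {e. \<forall>i. e $ i \<in> S i}"
proof (rule inj_onI)
  fix e e'
  assume e: "e \<in> {e. \<forall>i. e $ i \<in> S i}" and e': "e' \<in> {e. \<forall>i. e $ i \<in> S i}"
    and eq: "cl (Suc k) (y + \<pi> ^ k *s e) = cl (Suc k) (y + \<pi> ^ k *s e')"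
  have "y + \<pi> ^ k *s e - (y + \<pi> ^ k *s e') = \<pi> ^ k *s (e - e')"
    by (simp add: vec_eq_iff algebra_simps)
  then have "1 / real q ^ k * supnorm (e - e') \<le> 1 / real q ^ Suc k"
    using eq by (simp only: cl_eq_iff supnorm_scale absv_pi_power)
  then have "supnorm (e - e') \<le> 1 / real q"
    using q_pos by (simp add: field_simps)
  then have less: "absv (e $ i - e' $ i) < 1" for i
    by (simp add: absv_less_1_iff supnorm_le_iff)
  have "e $ i = e' $ i" for i
    using S[of i] e e' less[of i] D by (fastforce simp: digits_def)
  then show "e = e'"
    by (simp add: vec_eq_iff)
qed

lemma card_children_vec:
  assumes y: "y \<in> Rd"
  shows "card (cl (Suc k) ` {z \<in> Rd. cl k z = cl k (y :: 'k ^ 'd::finite)}) = q ^ CARD('d)"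
proof -
  obtain D where D: "digits D"
    using ex_digits by blast
  let ?E = "{e :: 'k ^ 'd. \<forall>i. e $ i \<in> D}"
  have "cl (Suc k) ` {z \<in> Rd. cl k z = cl k y} = (\<lambda>e. cl (Suc k) (y + \<pi> ^ k *s e)) ` ?E"
  proof (intro equalityI subsetI)
    fix c assume "c \<in> cl (Suc k) ` {z \<in> Rd. cl k z = cl k y}"
    then obtain z where z: "c = cl (Suc k) z" "supnorm (z - y) \<le> 1 / real q ^ k"
      by (auto simp: cl_eq_iff)
    then obtain r where r: "r \<in> Rd" "z - y = \<pi> ^ k *s r"
      using supnorm_power_iff by blast
    have "\<forall>i. \<exists>e\<in>D. absv (r $ i - e) < 1"
      using r D by (simp add: digits_def Rd_def)
    then obtain e where e: "\<And>i. e i \<in> D" "\<And>i. absv (r $ i - e i) < 1"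
      by metis
    have "supnorm (r - vec_lambda e) \<le> 1 / real q"
      using e(2) by (simp add: supnorm_le_iff absv_less_1_iff)
    moreover have "z - (y + \<pi> ^ k *s vec_lambda e) = \<pi> ^ k *s (r - vec_lambda e)"
      using r(2) by (simp add: vec_eq_iff algebra_simps)
    ultimately have "supnorm (z - (y + \<pi> ^ k *s vec_lambda e)) \<le> 1 / real q ^ Suc k"
      using q_pos by (simp only: supnorm_scale absv_pi_power) (simp add: field_simps)
    then have "c = cl (Suc k) (y + \<pi> ^ k *s vec_lambda e)"
      using z cl_eq_iff by blast
    then show "c \<in> (\<lambda>e. cl (Suc k) (y + \<pi> ^ k *s e)) ` ?E"
      using e(1) by auto
  next
    fix c assume "c \<in> (\<lambda>e. cl (Suc k) (y + \<pi> ^ k *s e)) ` ?E"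
    then obtain e where e: "e \<in> ?E" "c = cl (Suc k) (y + \<pi> ^ k *s e)"
      by blast
    then have "e \<in> Rd"
      using D by (auto simp: digits_def Rd_def)
    then have "y + \<pi> ^ k *s e \<in> Rd" "cl k (y + \<pi> ^ k *s e) = cl k y"
      using y by (auto simp: Rd_add Rd_scale pi_power_R cl_eq_iff supnorm_power_iff)
    then show "c \<in> cl (Suc k) ` {z \<in> Rd. cl k z = cl k y}"
      using e(2) by blast
  qed
  then have "card (cl (Suc k) ` {z \<in> Rd. cl k z = cl k y}) = card ?E"
    using card_image[OF digit_vec_inj[OF D, of "\<lambda>_. D" k y]] by simp
  also have "\<dots> = q ^ CARD('d)"
    using card_vec_boxes[of "\<lambda>_. D"] D by (simp add: digits_def)
  finally show ?thesis .
qed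

lemma finite_cl_image: "finite (cl k ` (Rd :: ('k ^ 'd::finite) set))"
proof (induction k)
  case 0
  have "cl 0 ` (Rd :: ('k ^ 'd) set) \<subseteq> {cl 0 0}"
    using cl_0 Rd_0 by blast
  then show ?case
    by (rule finite_subset) simp
next
  case (Suc k)
  have fin: "finite (cl (Suc k) ` {z \<in> Rd. cl k z = c})" if c: "c \<in> cl k ` (Rd :: ('k ^ 'd) set)" for c
  proof -
    obtain y :: "'k ^ 'd" where y: "y \<in> Rd" "c = cl k y"
      using c by blast
    have "card (cl (Suc k) ` {z \<in> Rd. cl k z = c}) = q ^ CARD('d)"
      unfolding y(2) by (rule card_children_vec[OF y(1)])
    \<comment> \<open>\<open>card\<close> is 0 on infinite sets, so a positive cardinality certifies
      finiteness.\<close>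
    then show ?thesis
      using q_gt_1 by (intro card_ge_0_finite) simp
  qed
  have eq: "cl (Suc k) ` (Rd :: ('k ^ 'd) set) =
      (\<Union>c\<in>cl k ` Rd. cl (Suc k) ` {z \<in> Rd. cl k z = c})"
    by blast
  show ?case
    unfolding eq using Suc fin by (rule finite_UN_I)
qed

section \<open>Vectors congruent to a point of a line\<close>

definition meets_line :: "nat \<Rightarrow> 'k ^ 'd::finite \<Rightarrow> 'k ^ 'd \<Rightarrow> bool" where
  "meets_line k a y \<longleftrightarrow> (\<exists>t\<in>R. supnorm (y - t *s a) \<le> 1 / real q ^ k)"

text \<open>The multiplier \<open>t\<close> can be kept: as \<open>absv t\<close> is at most 1,
  replacing \<open>a\<close> by a congruent vector moves \<open>t *s a\<close> by at most
  q^-k.\<close>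

lemma meets_line_cong:
  assumes "cl k a = cl k a'" "cl k y = cl k y'" "meets_line k a y"
  shows "meets_line k a' y'"
proof -
  obtain t where t: "t \<in> R" "supnorm (y - t *s a) \<le> 1 / real q ^ k"
    using assms(3) by (auto simp: meets_line_def)
  have "supnorm (t *s a - t *s a') = absv t * supnorm (a - a')"
    by (simp only: supnorm_scale flip: vec.scale_right_diff_distrib)
  also have "\<dots> \<le> 1 * (1 / real q ^ k)"
    using t(1) assms(1) supnorm_nonneg by (intro mult_mono) (auto simp: R_iff cl_eq_iff)
  finally have "supnorm (t *s a - t *s a') \<le> 1 / real q ^ k"
    by simp
  moreover have "supnorm (y' - y) \<le> 1 / real q ^ k"
    using assms(2) cl_eq_iff by metis
  ultimately show ?thesis
    using t supnorm_ultra unfolding meets_line_def by blast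
qed

lemma meets_line_mono: "\<lbrakk>meets_line k a y; j \<le> k\<rbrakk> \<Longrightarrow> meets_line j a y"
  using inverse_power_mono[of j k] unfolding meets_line_def by (meson order_trans)

text \<open>Since \<open>a\<close> has norm 1, distances between points of its line are distances
  between multipliers. The multipliers that agree with \<open>t\<close> modulo
  \<open>\<pi> ^ k\<close> are \<open>t + \<pi> ^ k * r\<close> with \<open>r\<close> in
  \<open>R\<close>, and at the next level only the digit of \<open>r\<close> counts, which leaves
  \<open>q\<close> classes.\<close>

lemma card_children_meets_line:
  fixes a :: "'k ^ 'd::finite"
  assumes a: "supnorm a = 1" and y: "y \<in> Rd" and G: "meets_line k a y"
  shows "card (cl (Suc k) ` {z \<in> Rd. cl k z = cl k y \<and> meets_line (Suc k) a z}) = q"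
proof -
  obtain D where D: "digits D"
    using ex_digits by blast
  obtain t where t: "t \<in> R" "supnorm (y - t *s a) \<le> 1 / real q ^ k"
    using G by (auto simp: meets_line_def)
  let ?p = "\<lambda>e. (t + \<pi> ^ k * e) *s a"
  have diff: "supnorm (s *s a - s' *s a) = absv (s - s')" for s s'
    using a by (simp only: supnorm_scale mult_1_right flip: vec.scale_left_diff_distrib)
  have "cl (Suc k) ` {z \<in> Rd. cl k z = cl k y \<and> meets_line (Suc k) a z} = (\<lambda>e. cl (Suc k) (?p e)) ` D"
  proof (intro equalityI subsetI)
    fix c assume "c \<in> cl (Suc k) ` {z \<in> Rd. cl k z = cl k y \<and> meets_line (Suc k) a z}"
    then obtain z s where z: "c = cl (Suc k) z" "supnorm (z - y) \<le> 1 / real q ^ k"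
      "s \<in> R" "supnorm (z - s *s a) \<le> 1 / real q ^ Suc k"
      by (auto simp: cl_eq_iff meets_line_def)
    have "supnorm (s *s a - z) \<le> 1 / real q ^ k"
      using z(4) inverse_power_mono[of k "Suc k"] by (simp add: supnorm_commute[of z])
    then have "supnorm (s *s a - t *s a) \<le> 1 / real q ^ k"
      using z(2) t(2) supnorm_ultra by blast
    then obtain r where r: "r \<in> R" "s - t = \<pi> ^ k * r"
      unfolding diff using absv_le_power_iff by blast
    then obtain e where e: "e \<in> D" "absv (r - e) < 1"
      using D unfolding digits_def by blast
    have "s - (t + \<pi> ^ k * e) = \<pi> ^ k * (r - e)"
      using r(2) by (simp add: algebra_simps)
    then have "supnorm (s *s a - ?p e) = 1 / real q ^ k * absv (r - e)"
      unfolding diff by (simp only: absv_mult absv_pi_power)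
    also have "\<dots> \<le> 1 / real q ^ Suc k"
      using e(2) q_pos by (simp add: absv_less_1_iff field_simps)
    finally have "supnorm (z - ?p e) \<le> 1 / real q ^ Suc k"
      using z(4) supnorm_ultra by blast
    then have "c = cl (Suc k) (?p e)"
      using z(1) cl_eq_iff by blast
    then show "c \<in> (\<lambda>e. cl (Suc k) (?p e)) ` D"
      using e by blast
  next
    fix c assume "c \<in> (\<lambda>e. cl (Suc k) (?p e)) ` D"
    then obtain e where e: "e \<in> D" "c = cl (Suc k) (?p e)"
      by blast
    have eR: "e \<in> R"
      using e(1) D by (auto simp: digits_def)
    have tR: "t + \<pi> ^ k * e \<in> R"
      using eR t by (simp add: R_add R_mult pi_power_R)
    have "?p e \<in> Rd"
      using tR a by (intro Rd_scale) (simp_all add: Rd_iff)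
    moreover have "meets_line (Suc k) a (?p e)"
      unfolding meets_line_def using tR q_pos by (intro bexI[OF _ tR]) (simp add: supnorm_eq_0[THEN iffD2])
    moreover have "supnorm (?p e - t *s a) \<le> 1 / real q ^ k"
      unfolding diff absv_le_power_iff using eR by auto
    then have "cl k (?p e) = cl k y"
      using t(2) supnorm_commute[of y] cl_eq_iff by metis
    ultimately show "c \<in> cl (Suc k) ` {z \<in> Rd. cl k z = cl k y \<and> meets_line (Suc k) a z}"
      using e(2) by blast
  qed
  moreover have "inj_on (\<lambda>e. cl (Suc k) (?p e)) D"
  proof (rule inj_onI)
    fix e e' assume e: "e \<in> D" "e' \<in> D" and "cl (Suc k) (?p e) = cl (Suc k) (?p e')"
    then have "absv (t + \<pi> ^ k * e - (t + \<pi> ^ k * e')) \<le> 1 / real q ^ Suc k"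
      by (simp only: cl_eq_iff diff)
    moreover have "t + \<pi> ^ k * e - (t + \<pi> ^ k * e') = \<pi> ^ k * (e - e')"
      by (simp add: algebra_simps)
    ultimately have "1 / real q ^ k * absv (e - e') \<le> 1 / real q ^ Suc k"
      by (simp only: absv_mult absv_pi_power)
    then have "absv (e - e') < 1"
      using q_pos unfolding absv_less_1_iff by (simp add: field_simps)
    then show "e = e'"
      using e D unfolding digits_def by blast
  qed
  ultimately show ?thesis
    using D by (simp add: card_image digits_def)
qed


subsection \<open>The tree of points of projective space\<close>

text \<open>The image of \<open>can\<close>, described on vectors so that lines can be left aside.
  Modulo \<pi> it is the reduced echelon form of a single row; the index \<open>j\<close> is called
  the pivot below.\<close>

definition canonical :: "('k ^ 'd::{finite,linorder}) set" where
  "canonical = {x \<in> Rd. \<exists>j. x $ j = 1 \<and> (\<forall>i<j. absv (x $ i) < 1)}"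

abbreviation line :: "'k ^ 'd::finite \<Rightarrow> ('k ^ 'd) set" where
  "line x \<equiv> vec.span {x}"

lemma canonical_Rd: "x \<in> canonical \<Longrightarrow> x \<in> Rd"
  by (simp add: canonical_def)

lemma canonical_supnorm:
  assumes "x \<in> canonical"
  shows "supnorm x = 1"
proof -
  obtain j where "x $ j = 1"
    using assms by (auto simp: canonical_def)
  then have "1 \<le> supnorm x"
    using absv_le_supnorm[of x j] absv_one by simp
  then show ?thesis
    using assms by (simp add: canonical_def Rd_iff)
qed

lemma is_can_iff: "is_can l x \<longleftrightarrow> x \<in> l \<and> x \<in> canonical"
  using canonical_supnorm[of x] unfolding is_can_def canonical_def unit_sphere_def Rd_iff
  by auto

lemma can_canonical:
  assumes "l \<in> proj_space"
  shows "can l \<in> canonical" and "line (can l) = l"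
proof -
  have c: "can l \<in> l \<and> can l \<in> canonical"
    using theI'[OF ex1_can[OF assms]] by (simp add: can_def is_can_iff)
  then show "can l \<in> canonical"
    by simp
  obtain v where v: "l = line v"
    using assms by (auto simp: proj_space_def)
  obtain s where s: "can l = s *s v"
    using c v by (auto simp: vec.span_singleton)
  have "can l \<noteq> 0"
    using c canonical_supnorm[of "can l"] supnorm_eq_0[of "can l"] by auto
  then have "v = inverse s *s can l"
    using s by auto
  then have "v \<in> line (can l)"
    by (auto simp: vec.span_singleton)
  then show "line (can l) = l"
    using c v by (simp add: vec.span_eq)
qed

lemma line_proj_space:
  assumes "x \<in> canonical"
  shows "line x \<in> proj_space" and "can (line x) = x"
proof -
  have "x \<noteq> 0"
    using assms canonical_supnorm[of x] supnorm_eq_0[of x] by auto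
  then show p: "line x \<in> proj_space"
    by (auto simp: proj_space_def)
  show "can (line x) = x"
    unfolding can_def using assms by (intro the1_equality ex1_can[OF p])
      (simp add: is_can_iff vec.span_base)
qed

lemma proj_space_eq: "proj_space = line ` canonical"
  using line_proj_space(1) can_canonical by (metis (no_types, lifting) image_iff subsetI subset_antisym)

text \<open>If the pivots agree, the pivot coordinate alone bounds \<open>absv (w - 1)\<close> by
  the right-hand side, so passing from \<open>w *s y\<close> to \<open>y\<close> costs nothing. If
  they differ, the coordinate at the earlier pivot is the difference of a unit and a non-unit, so
  the right-hand side is at least 1, which bounds the left-hand side anyway.\<close>

lemma supnorm_canonical_le:
  assumes x: "x \<in> canonical" and y: "y \<in> canonical" and w: "absv w = 1"
  shows "supnorm (x - y) \<le> supnorm (x - w *s y)"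
proof -
  obtain i where i: "x $ i = 1" "\<And>h. h < i \<Longrightarrow> absv (x $ h) < 1"
    using x by (auto simp: canonical_def)
  obtain j where j: "y $ j = 1" "\<And>h. h < j \<Longrightarrow> absv (y $ h) < 1"
    using y by (auto simp: canonical_def)
  have comp: "absv (x $ h - w * y $ h) \<le> supnorm (x - w *s y)" for h
    using absv_le_supnorm[of "x - w *s y" h] by simp
  have le1: "supnorm (x - y) \<le> 1"
    using supnorm_diff[of x y] canonical_supnorm[OF x] canonical_supnorm[OF y] by simp
  consider "i = j" | "i < j" | "j < i"
    by (meson linorder_cases)
  then show ?thesis
  proof cases
    case 1
    then have "absv (w - 1) \<le> supnorm (x - w *s y)"
      using comp[of i] i j by (simp add: absv_diff_commute)
    then have "supnorm ((w - 1) *s y) \<le> supnorm (x - w *s y)"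
      by (simp only: supnorm_scale canonical_supnorm[OF y] mult_1_right)
    moreover have "x - y = (x - w *s y) + (w - 1) *s y"
      by (simp add: vec_eq_iff algebra_simps)
    ultimately show ?thesis
      using supnorm_add[of "x - w *s y" "(w - 1) *s y"] by (simp only: max.absorb1)
  next
    case 2
    have "absv (w * y $ i) < 1"
      using j(2)[OF 2] w by (simp add: absv_mult)
    then have "1 \<le> absv (x $ i - w * y $ i)"
      using absv_add[of "x $ i - w * y $ i" "w * y $ i"] i(1) absv_one by simp
    then show ?thesis
      using comp[of i] le1 by linarith
  next
    case 3
    have "absv (w * y $ j) = 1" "absv (x $ j) < 1"
      using i(2)[OF 3] w j(1) by (simp_all add: absv_mult absv_one)
    then have "1 \<le> absv (x $ j - w * y $ j)"
      using absv_diff[of "x $ j" "x $ j - w * y $ j"] by simp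
    then show ?thesis
      using comp[of j] le1 by linarith
  qed
qed

text \<open>Multiplying both representatives by a unit preserves the norm of their difference, so
  only one unit factor \<open>c / b\<close> has to be compared with 1; this is
  \<open>supnorm_canonical_le\<close>, and the infimum is a minimum.\<close>

lemma proj_dist_line:
  assumes x: "x \<in> canonical" and y: "y \<in> canonical"
  shows "proj_dist (line x) (line y) = supnorm (x - y)"
  unfolding proj_dist_def
proof (rule cInf_eq_minimum)
  have "x \<in> line x \<inter> unit_sphere" "y \<in> line y \<inter> unit_sphere"
    using x y by (auto simp: unit_sphere_def canonical_supnorm vec.span_base)
  then show "supnorm (x - y) \<in>
      {supnorm (v - w) |v w. v \<in> line x \<inter> unit_sphere \<and> w \<in> line y \<inter> unit_sphere}"
    by blast
  fix r
  assume "r \<in> {supnorm (v - w) |v w. v \<in> line x \<inter> unit_sphere \<and> w \<in> line y \<inter> unit_sphere}"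
  then obtain v w where r: "r = supnorm (v - w)" and v: "v \<in> line x" "supnorm v = 1"
    and w: "w \<in> line y" "supnorm w = 1"
    by (auto simp: unit_sphere_def)
  obtain b c where b: "v = b *s x" and c: "w = c *s y"
    using v(1) w(1) by (auto simp: vec.span_singleton)
  have abs: "absv b = 1" "absv c = 1"
    using v(2) w(2) b c canonical_supnorm[OF x] canonical_supnorm[OF y]
    by (auto simp: supnorm_scale)
  then have b0: "b \<noteq> 0"
    using absv_eq_0[of b] by auto
  have "absv b * absv (c / b) = absv c"
    using b0 by (simp flip: absv_mult)
  then have "absv (c / b) = 1"
    using abs by simp
  then have "supnorm (x - y) \<le> supnorm (x - (c / b) *s y)"
    using x y by (intro supnorm_canonical_le)
  also have "\<dots> = supnorm (b *s (x - (c / b) *s y))"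
    using abs by (simp only: supnorm_scale mult_1_left)
  also have "b *s (x - (c / b) *s y) = v - w"
    using b0 by (simp add: b c vec_eq_iff field_simps)
  finally show "supnorm (x - y) \<le> r"
    using r by simp
qed

text \<open>For positive \<open>k\<close>, congruent canonical vectors have the same pivot, with
  entry 1 in both. So the digit at the pivot is 0 and the other d - 1 digits are free. Modulo
  \<open>\<pi> ^ 0\<close> the pivot is not determined, which is why the root is counted
  separately.\<close>

lemma card_children_canonical:
  fixes y :: "'k ^ 'd::{finite,linorder}"
  assumes y: "y \<in> canonical" and k: "0 < k"
  shows "card (cl (Suc k) ` {z \<in> canonical. cl k z = cl k y}) = q ^ (CARD('d) - 1)"
proof -
  obtain D where D: "digits D"
    using ex_digits by blast
  obtain j where j: "y $ j = 1" "\<And>i. i < j \<Longrightarrow> absv (y $ i) < 1"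
    using y by (auto simp: canonical_def)
  let ?S = "\<lambda>i. if i = j then {0} else D"
  let ?E = "{e :: ('k, 'd) vec. \<forall>i. e $ i \<in> ?S i}"
  have pi: "absv (\<pi> ^ k * r) < 1" if "r \<in> R" for r
  proof -
    have "absv (\<pi> ^ k * r) \<le> 1 / real q ^ k"
      using that absv_le_power_iff by blast
    also have "\<dots> < 1"
      using q_pos k by simp
    finally show ?thesis .
  qed
  have "cl (Suc k) ` {z \<in> canonical. cl k z = cl k y} = (\<lambda>e. cl (Suc k) (y + \<pi> ^ k *s e)) ` ?E"
  proof (intro equalityI subsetI)
    fix c assume "c \<in> cl (Suc k) ` {z \<in> canonical. cl k z = cl k y}"
    then obtain z where z: "z \<in> canonical" "c = cl (Suc k) z" "supnorm (z - y) \<le> 1 / real q ^ k"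
      by (auto simp: cl_eq_iff)
    then obtain r where r: "r \<in> Rd" "z - y = \<pi> ^ k *s r"
      using supnorm_power_iff by blast
    have zr: "z $ i = y $ i + \<pi> ^ k * r $ i" for i
      using r(2) by (simp add: vec_eq_iff algebra_simps)
    have close: "absv (z $ i - y $ i) < 1" for i
      using pi[of "r $ i"] r(1) zr[of i] by (simp add: Rd_def)
    obtain j' where j': "z $ j' = 1" "\<And>i. i < j' \<Longrightarrow> absv (z $ i) < 1"
      using z by (auto simp: canonical_def)
    have "\<not> j' < j"
      using close[of j'] j(2)[of j'] j'(1) absv_add[of "z $ j' - y $ j'" "y $ j'"] absv_one by auto
    moreover have "\<not> j < j'"
      using close[of j] j'(2)[of j] j(1) absv_diff[of "z $ j" "z $ j - y $ j"] absv_one by auto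
    ultimately have rj: "r $ j = 0"
      using zr[of j] j(1) j'(1) uniformizer_nonzero by auto
    have "\<forall>i. \<exists>e\<in>?S i. absv (r $ i - e) < 1"
      using r D rj by (auto simp: digits_def Rd_def absv_eq_0[THEN iffD2])
    then obtain e where e: "\<And>i. e i \<in> ?S i" "\<And>i. absv (r $ i - e i) < 1"
      by metis
    have "supnorm (r - vec_lambda e) \<le> 1 / real q"
      using e(2) by (simp add: supnorm_le_iff absv_less_1_iff)
    moreover have "z - (y + \<pi> ^ k *s vec_lambda e) = \<pi> ^ k *s (r - vec_lambda e)"
      using r(2) by (simp add: vec_eq_iff algebra_simps)
    ultimately have "supnorm (z - (y + \<pi> ^ k *s vec_lambda e)) \<le> 1 / real q ^ Suc k"
      using q_pos by (simp only: supnorm_scale absv_pi_power) (simp add: field_simps)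
    then have "c = cl (Suc k) (y + \<pi> ^ k *s vec_lambda e)"
      using z cl_eq_iff by blast
    moreover have "vec_lambda e \<in> ?E"
      using e(1) by (simp only: mem_Collect_eq vec_lambda_beta) simp
    ultimately show "c \<in> (\<lambda>e. cl (Suc k) (y + \<pi> ^ k *s e)) ` ?E"
      by blast
  next
    fix c assume "c \<in> (\<lambda>e. cl (Suc k) (y + \<pi> ^ k *s e)) ` ?E"
    then obtain e where e: "\<And>i. e $ i \<in> ?S i" "c = cl (Suc k) (y + \<pi> ^ k *s e)"
      by blast
    have eR: "e $ i \<in> R" for i
      using e(1)[of i] D R_simps by (auto simp: digits_def split: if_splits)
    then have eRd: "e \<in> Rd"
      by (simp add: Rd_def)
    have "y + \<pi> ^ k *s e \<in> canonical"
      unfolding canonical_def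
    proof (intro CollectI conjI exI[of _ j] allI impI)
      show "y + \<pi> ^ k *s e \<in> Rd"
        using eRd y by (simp add: Rd_add Rd_scale pi_power_R canonical_Rd)
      show "(y + \<pi> ^ k *s e) $ j = 1"
        using e(1)[of j] j(1) by simp
      fix i assume "i < j"
      then show "absv ((y + \<pi> ^ k *s e) $ i) < 1"
        using absv_add[of "y $ i" "\<pi> ^ k * e $ i"] j(2)[of i] pi[OF eR[of i]] by simp
    qed
    moreover have "cl k (y + \<pi> ^ k *s e) = cl k y"
      using eRd by (auto simp: cl_eq_iff supnorm_power_iff)
    ultimately show "c \<in> cl (Suc k) ` {z \<in> canonical. cl k z = cl k y}"
      using e(2) by blast
  qed
  moreover have "inj_on (\<lambda>e. cl (Suc k) (y + \<pi> ^ k *s e)) ?E"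
    by (rule digit_vec_inj[OF D]) auto
  ultimately have "card (cl (Suc k) ` {z \<in> canonical. cl k z = cl k y}) = card ?E"
    by (simp only: card_image)
  also have "\<dots> = (\<Prod>i\<in>UNIV. card (?S i))"
    by (rule card_vec_boxes)
  also have "\<dots> = (\<Prod>i\<in>UNIV - {j}. q)"
    using D by (subst prod.remove[of _ j]) (auto simp: digits_def intro!: prod.cong)
  also have "\<dots> = q ^ (CARD('d) - 1)"
    by simp
  finally show ?thesis .
qed

text \<open>The points of projective space over the residue field, counted by Schubert cells: with
  pivot \<open>j\<close>, entries before it are 0 and each of the entries after it is one of
  \<open>q\<close> digits.\<close>

lemma card_cl_1_canonical:
  "card (cl 1 ` (canonical :: ('k ^ 'd::{finite,linorder}) set)) = (\<Sum>i<CARD('d). q ^ i)"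
proof -
  obtain D where D: "digits D"
    using ex_digits by blast
  let ?S = "\<lambda>j i. if i < j then {0} else if i = j then {1} else D"
  let ?B = "\<lambda>j. {e :: ('k, 'd) vec. \<forall>i. e $ i \<in> ?S j i}"
  have B_canonical: "e \<in> canonical" if e: "e \<in> ?B j" for e j
  proof -
    have e: "\<And>i. e $ i \<in> ?S j i"
      using that by blast
    have "e $ i \<in> R" for i
      using e[of i] D R_simps by (auto simp: digits_def split: if_splits)
    moreover have "e $ j = 1"
      using e[of j] by simp
    moreover have "absv (e $ i) < 1" if "i < j" for i
      using e[of i] that by (simp add: absv_eq_0[THEN iffD2])
    ultimately show ?thesis
      by (auto simp: canonical_def Rd_def)
  qed
  \<comment> \<open>One fact for two purposes: reduction modulo \<pi> is injective on the union of
    the cells, and the cells are disjoint.\<close>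
  have same: "e = e' \<and> j = j'" if e: "e \<in> ?B j" and e': "e' \<in> ?B j'" and eq: "cl 1 e = cl 1 e'"
    for e e' j j'
  proof -
    have E: "\<And>i. e $ i \<in> ?S j i" "\<And>i. e' $ i \<in> ?S j' i"
      using e e' by blast+
    have close: "absv (e $ i - e' $ i) < 1" for i
      using eq by (simp add: cl_eq_iff supnorm_le_iff absv_less_1_iff)
    have "\<not> j < j'"
      using E(1)[of j] E(2)[of j] close[of j] by (auto simp: absv_one)
    moreover have "\<not> j' < j"
      using E(1)[of j'] E(2)[of j'] close[of j'] by (auto simp: absv_one absv_minus)
    ultimately have jj: "j = j'"
      by simp
    have "inj_on (\<lambda>e. cl (Suc 0) (0 + \<pi> ^ 0 *s e)) (?B j)"
      by (rule digit_vec_inj[OF D]) auto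
    then have "inj_on (cl 1) (?B j)"
      by simp
    then show ?thesis
      using e e' eq jj by (auto dest: inj_onD)
  qed
  have "cl 1 ` canonical = cl 1 ` (\<Union>j. ?B j)"
  proof (intro equalityI image_subsetI)
    fix z :: "('k, 'd) vec" assume z: "z \<in> canonical"
    then obtain j where j: "z $ j = 1" "\<And>i. i < j \<Longrightarrow> absv (z $ i) < 1"
      by (auto simp: canonical_def)
    have "\<forall>i. \<exists>e\<in>?S j i. absv (z $ i - e) < 1"
      using canonical_Rd[OF z] D j by (auto simp: digits_def Rd_def absv_eq_0[THEN iffD2])
    then obtain e where e: "\<And>i. e i \<in> ?S j i" "\<And>i. absv (z $ i - e i) < 1"
      by metis
    have "cl 1 z = cl 1 (vec_lambda e)"
      using e(2) by (simp add: cl_eq_iff supnorm_le_iff absv_less_1_iff)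
    moreover have "vec_lambda e \<in> ?B j"
      using e(1) by (simp only: mem_Collect_eq vec_lambda_beta) simp
    ultimately show "cl 1 z \<in> cl 1 ` (\<Union>j. ?B j)"
      by blast
  next
    fix e assume "e \<in> (\<Union>j. ?B j)"
    then obtain j where "e \<in> ?B j"
      by blast
    then have "e \<in> canonical"
      by (rule B_canonical)
    then show "cl 1 e \<in> cl 1 ` canonical"
      by (rule imageI)
  qed
  moreover have "inj_on (cl 1) (\<Union>j. ?B j)"
    by (rule inj_onI) (metis (no_types, lifting) UN_E same)
  ultimately have "card (cl 1 ` (canonical :: (('k, 'd) vec) set)) = card (\<Union>j. ?B j)"
    by (simp only: card_image)
  also have "\<dots> = (\<Sum>j\<in>UNIV. card (?B j))"
  proof (rule card_UN_disjoint)
    show "\<forall>j\<in>UNIV. finite (?B j)"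
    proof
      fix j
      have "card (?B j) = (\<Prod>i\<in>UNIV. card (?S j i))"
        by (rule card_vec_boxes)
      also have "0 < \<dots>"
        using D q_gt_1 by (intro prod_pos) (auto simp: digits_def)
      finally show "finite (?B j)"
        by (rule card_ge_0_finite)
    qed
    show "\<forall>j\<in>UNIV. \<forall>j'\<in>UNIV. j \<noteq> j' \<longrightarrow> ?B j \<inter> ?B j' = {}"
      using same by blast
  qed simp
  also have "\<dots> = (\<Sum>j\<in>(UNIV :: 'd set). q ^ card {i. j < i})"
  proof (rule sum.cong[OF refl])
    fix j
    have "card (?B j) = (\<Prod>i\<in>UNIV. card (?S j i))"
      by (rule card_vec_boxes)
    also have "\<dots> = (\<Prod>i\<in>UNIV. if j < i then q else 1)"
      using D by (intro prod.cong) (auto simp: digits_def)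
    also have "\<dots> = (\<Prod>i | j < i. q)"
      using prod.inter_filter[of UNIV "\<lambda>_. q" "\<lambda>i. j < i"] by simp
    finally show "card (?B j) = q ^ card {i. j < i}"
      by simp
  qed
  also have "\<dots> = (\<Sum>i<CARD('d). q ^ i)"
    by (rule sum_card_greater)
  finally show ?thesis .
qed

section \<open>Finite systems of representatives and the count of labellings\<close>

definition transversal :: "nat \<Rightarrow> ('k ^ 'd::finite) set \<Rightarrow> ('k ^ 'd) set \<Rightarrow> bool" where
  "transversal n S A \<longleftrightarrow> A \<subseteq> S \<and> inj_on (cl n) A \<and> cl n ` A = cl n ` S"

lemma ex_transversal: "\<exists>A. transversal n S A"
  using subset_image_inj[of "cl n ` S" "cl n" S] unfolding transversal_def by (metis order_refl)

lemma finite_transversal: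
  fixes S :: "('k ^ 'd::finite) set"
  assumes "transversal n S A" "S \<subseteq> Rd"
  shows "finite A"
proof -
  have "finite (cl n ` S)"
    using image_mono[OF assms(2)] finite_cl_image by (rule finite_subset)
  then show ?thesis
    using assms(1) finite_imageD[of "cl n" A] by (simp add: transversal_def)
qed

text \<open>Digit expansions leave the chosen representatives, so classes are counted in all of
  \<open>S\<close>. Predicates that depend only on the class at a level \<open>k\<close> up to
  \<open>n\<close> transfer the count to \<open>A\<close>.\<close>

lemma transversal_image:
  assumes A: "transversal n S A" and k: "k \<le> n"
    and P: "\<And>x y. \<lbrakk>x \<in> S; y \<in> S; cl k x = cl k y; P x\<rbrakk> \<Longrightarrow> P y"
  shows "cl k ` {a \<in> A. P a} = cl k ` {a \<in> S. P a}"
proof (intro equalityI image_subsetI)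
  fix x assume "x \<in> {a \<in> A. P a}"
  then show "cl k x \<in> cl k ` {a \<in> S. P a}"
    using A by (auto simp: transversal_def)
next
  fix x assume x: "x \<in> {a \<in> S. P a}"
  then have "cl n x \<in> cl n ` A"
    using A by (simp add: transversal_def)
  then obtain a where a: "a \<in> A" "cl n x = cl n a"
    by blast
  from a(2) k have eq: "cl k x = cl k a"
    by (rule cl_mono)
  have "P a"
    using P[of x a] eq x a(1) A by (auto simp: transversal_def)
  then show "cl k x \<in> cl k ` {a \<in> A. P a}"
    using a eq by blast
qed

text \<open>The labellings of the whole tree, that is, \<open>funs\<close> at the root; they will be
  the reductions of the maps in \<Omega>.\<close>

definition level_maps :: "nat \<Rightarrow> ('k ^ 'd::finite) set \<Rightarrow> ('k ^ 'd) set \<Rightarrow> ('k ^ 'd \<Rightarrow> 'k ^ 'd) set" where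
  "level_maps n A Y =
     {g \<in> A \<rightarrow>\<^sub>E Y. \<forall>j\<le>n. \<forall>a\<in>A. \<forall>b\<in>A. cl j a = cl j b \<longrightarrow> cl j (g a) = cl j (g b)}"

text \<open>This is \<open>bad_ratio\<close> with \<open>s = q\<close> and
  \<open>Q = q ^ (CARD('d) - 1)\<close>, followed by rewriting the power \<open>?b ^ ?M\<close> in
  terms of \<open>1 - u n = ?b ^ ?Q\<close>.\<close>

lemma card_level_maps_avoiding:
  fixes A Y :: "('k ^ 'd::{finite,linorder}) set"
  assumes A: "transversal n canonical A" and Y: "transversal n Rd Y"
    and n: "0 < n" and d: "2 \<le> CARD('d)"
    and u_0: "u 0 = 1"
    and u_Suc: "\<And>m. u (Suc m) = 1 - (1 - u m / real q ^ (CARD('d) - 1)) ^ (q ^ (CARD('d) - 1))"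
  shows "real (card {g \<in> level_maps n A Y. \<forall>a\<in>A. \<not> meets_line n a (g a)}) =
    (1 - u n) powr (\<Sum>i<CARD('d). 1 / real q ^ i) * real (card (level_maps n A Y))"
proof -
  have sub: "A \<subseteq> canonical" "Y \<subseteq> Rd" "(canonical :: (('k, 'd) vec) set) \<subseteq> Rd"
    using A Y by (auto simp: transversal_def canonical_Rd)
  interpret level_functions A Y n cl cl
  proof
    show "finite A" "finite Y"
      using finite_transversal A Y sub by blast+
    show "inj_on (cl n) A" "inj_on (cl n) Y"
      using A Y by (auto simp: transversal_def)
  qed (rule cl_mono; assumption)+
  let ?Q = "q ^ (CARD('d) - 1)"
  interpret galton_watson A Y n cl cl meets_line ?Q q u
  proof
    fix k y assume k: "k < n" and y: "y \<in> Y"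
    have "cl (Suc k) ` fibY k (cl k y) = cl (Suc k) ` {z \<in> Rd. cl k z = cl k y}"
      unfolding fibY_def using k by (intro transversal_image[OF Y]) (auto dest: cl_mono[of "Suc k" _ _ k])
    moreover have "q ^ CARD('d) = q * ?Q"
      using d by (cases "CARD('d)") auto
    ultimately show "card (cl (Suc k) ` fibY k (cl k y)) = q * ?Q"
      using card_children_vec[of y k] y sub by auto
    fix a assume a: "a \<in> A" and G: "meets_line k a y"
    have "cl (Suc k) ` {y' \<in> fibY k (cl k y). meets_line (Suc k) a y'} =
        cl (Suc k) ` {y' \<in> Y. cl k y' = cl k y \<and> meets_line (Suc k) a y'}"
      by (rule arg_cong[where f = "image (cl (Suc k))"]) (auto simp: fibY_def)
    also have "\<dots> = cl (Suc k) ` {z \<in> Rd. cl k z = cl k y \<and> meets_line (Suc k) a z}"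
      using k
      by (intro transversal_image[OF Y])
        (auto dest: cl_mono[of "Suc k" _ _ k] intro: meets_line_cong[OF refl])
    also have "card \<dots> = q"
      using a y sub canonical_supnorm by (intro card_children_meets_line G) auto
    finally show "card (cl (Suc k) ` {y' \<in> fibY k (cl k y). meets_line (Suc k) a y'}) = q" .
  next
    fix k a assume k: "0 < k" "k < n" and a: "a \<in> A"
    have "cl (Suc k) ` fibA k (cl k a) = cl (Suc k) ` {z \<in> canonical. cl k z = cl k a}"
      unfolding fibA_def using k by (intro transversal_image[OF A]) (auto dest: cl_mono[of "Suc k" _ _ k])
    then show "card (cl (Suc k) ` fibA k (cl k a)) = ?Q"
      using card_children_canonical[of a k] k a sub by auto
  qed (use q_gt_1 u_0 u_Suc in \<open>auto intro: meets_line_cong meets_line_mono\<close>)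
  \<comment> \<open>\<open>?M\<close> is the number of children of the root, and \<open>?b\<close>
    the proportion contributed by one child having no surviving leaf below it.\<close>
  let ?M = "\<Sum>i<CARD('d). q ^ i" and ?b = "1 - u (n - 1) / real ?Q"
  have card1: "card (cl 1 ` A) = ?M"
    using transversal_image[OF A, of 1 "\<lambda>_. True"] n card_cl_1_canonical[where 'd = 'd] by simp
  have "0 < ?M"
    using q_gt_1 d by (intro sum_pos) (auto simp: lessThan_empty_iff)
  then obtain a where a: "a \<in> A"
    using card1 by fastforce
  have "cl n 0 \<in> cl n ` Y"
    using Y by (simp add: transversal_def Rd_0)
  then obtain y where y: "y \<in> Y"
    by blast
  have "cl 0 b = cl 0 a" if "b \<in> A" for b
    using that a sub by (intro cl_0) auto
  moreover have "cl 0 z = cl 0 y" if "z \<in> Y" for z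
    using that y sub by (intro cl_0) auto
  ultimately have fib: "fibA 0 (cl 0 a) = A" "fibY 0 (cl 0 y) = Y"
    unfolding fibA_def fibY_def by blast+
  have funs: "funs \<Phi> 0 (cl 0 a) (cl 0 y) = {g \<in> level_maps n A Y. \<forall>a\<in>A. \<Phi> a (g a)}" for \<Phi>
    unfolding funs_def fib level_maps_def compat_def by auto
  \<comment> \<open>At level 0 every vector of \<open>Rd\<close> is within distance 1 of the origin,
    so the root always survives.\<close>
  have "meets_line 0 a y"
    using y sub R_simps by (auto simp: meets_line_def Rd_iff intro!: bexI[of _ 0])
  from bad_ratio[OF n a y this]
  have ratio: "real (card {g \<in> level_maps n A Y. \<forall>a\<in>A. \<not> meets_line n a (g a)}) =
      ?b ^ ?M * real (card (level_maps n A Y))"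
    by (simp add: funs fib card1[unfolded One_nat_def])
  \<comment> \<open>With \<open>Q\<close> at least 2 and \<open>u m\<close> in [0, 1] the base
    \<open>?b\<close> is strictly positive, so that natural powers may be rewritten with
    \<open>powr\<close>.\<close>
  have Q: "2 \<le> ?Q"
    using q_gt_1 d self_le_power[of q "CARD('d) - 1"] by linarith
  have frac: "x / real ?Q < 1 \<and> 0 \<le> x / real ?Q" if "0 \<le> x \<and> x \<le> 1" for x :: real
  proof -
    have "0 < real ?Q" "x < 1 * real ?Q"
      using that Q by linarith+
    then show ?thesis
      using that by (simp only: pos_divide_less_eq) (simp add: divide_nonneg_pos)
  qed
  have u01: "0 \<le> u m \<and> u m \<le> 1" for m
  proof (induction m)
    case (Suc m)
    have "u m / real ?Q < 1" "0 \<le> u m / real ?Q"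
      using frac Suc by auto
    then have "0 \<le> 1 - u m / real ?Q" "1 - u m / real ?Q \<le> 1"
      by linarith+
    then show ?case
      unfolding u_Suc using power_le_one[of "1 - u m / real ?Q" ?Q] zero_le_power[of "1 - u m / real ?Q" ?Q]
      by simp
  qed (simp add: u_0)
  have b: "0 < ?b"
    using frac u01[of "n - 1"] by simp
  have "real ?M = real ?Q * (\<Sum>i<CARD('d). 1 / real q ^ i)"
  proof -
    \<comment> \<open>Reversing the summation order replaces q^i by q^(d-1-i) = Q / q^i.\<close>
    have "(\<Sum>i<CARD('d). real q ^ i) = (\<Sum>i<CARD('d). real q ^ (CARD('d) - Suc i))"
      by (rule sum.nat_diff_reindex[symmetric])
    also have "\<dots> = (\<Sum>i<CARD('d). real ?Q * (1 / real q ^ i))"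
    proof (rule sum.cong[OF refl])
      fix i assume "i \<in> {..<CARD('d)}"
      then have "real ?Q = real q ^ (CARD('d) - Suc i) * real q ^ i"
        by (simp flip: power_add)
      then show "real q ^ (CARD('d) - Suc i) = real ?Q * (1 / real q ^ i)"
        using q_pos by simp
    qed
    finally show ?thesis
      by (simp add: sum_distrib_left)
  qed
  moreover have "1 - u n = ?b ^ ?Q"
    using u_Suc[of "n - 1"] n by simp
  then have "1 - u n = ?b powr real ?Q"
    using b by (simp only: powr_realpow)
  ultimately have "(1 - u n) powr (\<Sum>i<CARD('d). 1 / real q ^ i) = ?b powr real ?M"
    by (simp only: powr_powr)
  also have "\<dots> = ?b ^ ?M"
    using b by (rule powr_realpow)
  finally show ?thesis
    using ratio by simp
qed


subsection \<open>The Haar measure on 1-Lipschitz functions\<close>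

lemma \<Omega>_I:
  fixes f :: "('k ^ 'd::{finite,linorder}) set \<Rightarrow> ('k, 'd) vec"
  assumes "f \<in> extensional proj_space" "\<And>x. x \<in> canonical \<Longrightarrow> f (line x) \<in> Rd"
    and "\<And>x y. \<lbrakk>x \<in> canonical; y \<in> canonical\<rbrakk> \<Longrightarrow> supnorm (f (line x) - f (line y)) \<le> supnorm (x - y)"
  shows "f \<in> \<Omega>"
  using assms by (auto simp: \<Omega>_def PiE_def proj_space_eq proj_dist_line)

lemma \<Omega>_D:
  fixes f :: "('k ^ 'd::{finite,linorder}) set \<Rightarrow> ('k, 'd) vec"
  assumes "f \<in> \<Omega>"
  shows "f \<in> extensional proj_space"
    and "x \<in> canonical \<Longrightarrow> f (line x) \<in> Rd"
    and "\<lbrakk>x \<in> canonical; y \<in> canonical\<rbrakk> \<Longrightarrow> supnorm (f (line x) - f (line y)) \<le> supnorm (x - y)"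
  using assms by (auto simp: \<Omega>_def PiE_def proj_space_eq proj_dist_line)

lemma \<Omega>_cl:
  fixes f :: "('k ^ 'd::{finite,linorder}) set \<Rightarrow> ('k, 'd) vec"
  assumes "f \<in> \<Omega>" "x \<in> canonical" "y \<in> canonical" "cl k x = cl k y"
  shows "cl k (f (line x)) = cl k (f (line y))"
  using \<Omega>_D(3)[OF assms(1-3)] assms(4) by (simp add: cl_eq_iff)

lemma const_\<Omega>:
  fixes x :: "'k ^ 'd::{finite,linorder}"
  assumes "x \<in> Rd"
  shows "(\<lambda>a\<in>proj_space. x) \<in> \<Omega>"
proof (rule \<Omega>_I)
  fix v w :: "('k, 'd) vec" assume v: "v \<in> canonical" and w: "w \<in> canonical"
  then show "supnorm ((\<lambda>a\<in>proj_space. x) (line v) - (\<lambda>a\<in>proj_space. x) (line w)) \<le> supnorm (v - w)"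
    using supnorm_nonneg[of "v - w"] supnorm_eq_0[of "0 :: ('k, 'd) vec"]
    by (simp add: line_proj_space)
qed (simp_all add: assms line_proj_space)

lemma add\<Omega>_line: "x \<in> canonical \<Longrightarrow> add\<Omega> f g (line x) = f (line x) + g (line x)"
  by (simp add: add\<Omega>_def line_proj_space)

lemma add\<Omega>_in_\<Omega>:
  fixes f g :: "('k ^ 'd::{finite,linorder}) set \<Rightarrow> ('k, 'd) vec"
  assumes "f \<in> \<Omega>" "g \<in> \<Omega>"
  shows "add\<Omega> f g \<in> \<Omega>"
proof (rule \<Omega>_I)
  fix x y :: "('k, 'd) vec" assume x: "x \<in> canonical" and y: "y \<in> canonical"
  have "add\<Omega> f g (line x) - add\<Omega> f g (line y) =
      (f (line x) - f (line y)) + (g (line x) - g (line y))"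
    using x y by (simp add: add\<Omega>_line)
  then show "supnorm (add\<Omega> f g (line x) - add\<Omega> f g (line y)) \<le> supnorm (x - y)"
    using supnorm_add[of "f (line x) - f (line y)" "g (line x) - g (line y)"]
      \<Omega>_D(3)[OF assms(1) x y] \<Omega>_D(3)[OF assms(2) x y] by simp
qed (use assms in \<open>auto simp: add\<Omega>_line \<Omega>_D Rd_add\<close>, simp add: add\<Omega>_def)

lemma uminus_\<Omega>:
  fixes f :: "('k ^ 'd::{finite,linorder}) set \<Rightarrow> ('k, 'd) vec"
  assumes "f \<in> \<Omega>"
  shows "(\<lambda>l\<in>proj_space. - f l) \<in> \<Omega>"
proof (rule \<Omega>_I)
  fix x y :: "('k, 'd) vec" assume x: "x \<in> canonical" and y: "y \<in> canonical"
  then show "supnorm ((\<lambda>l\<in>proj_space. - f l) (line x) - (\<lambda>l\<in>proj_space. - f l) (line y)) \<le> supnorm (x - y)"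
    using \<Omega>_D(3)[OF assms y x] by (simp add: line_proj_space supnorm_commute)
qed (use assms in \<open>auto simp: line_proj_space intro!: Rd_minus \<Omega>_D(2)\<close>)

lemma add\<Omega>_uminus:
  fixes f g :: "('k ^ 'd::{finite,linorder}) set \<Rightarrow> ('k, 'd) vec"
  assumes "g \<in> \<Omega>"
  shows "add\<Omega> f (add\<Omega> (\<lambda>l\<in>proj_space. - f l) g) = g"
  using \<Omega>_D(1)[OF assms] by (auto simp: add\<Omega>_def fun_eq_iff extensional_def)

lemma supnorm_le_\<Omega>_dist:
  fixes f g :: "('k ^ 'd::{finite,linorder}) set \<Rightarrow> ('k, 'd) vec"
  assumes f: "f \<in> \<Omega>" and g: "g \<in> \<Omega>" and x: "x \<in> canonical"
  shows "supnorm (f (line x) - g (line x)) \<le> \<Omega>_dist f g"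
proof -
  have "bdd_above ((\<lambda>l. supnorm (f l - g l)) ` proj_space)"
  proof (rule bdd_aboveI2)
    fix l :: "('k, 'd) vec set" assume "l \<in> proj_space"
    then have "f l \<in> Rd" "g l \<in> Rd"
      using f g by (auto simp: \<Omega>_def)
    then show "supnorm (f l - g l) \<le> 1"
      using Rd_diff Rd_iff by blast
  qed
  then have "supnorm (f (line x) - g (line x)) \<le> (SUP l\<in>proj_space. supnorm (f l - g l))"
    using x by (intro cSUP_upper2[of _ _ "line x"] line_proj_space order_refl)
  then show ?thesis
    using f g by (simp add: \<Omega>_dist_def)
qed

text \<open>Unions of cosets of the subgroup of maps with values in \<open>\<pi> ^ n\<close> times
  \<open>Rd\<close>. This subgroup is open, so all events below are open and hence
  measurable.\<close>

definition level_set ::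
    "nat \<Rightarrow> (('k ^ 'd::{finite,linorder}) set \<Rightarrow> 'k ^ 'd::{finite,linorder}) set \<Rightarrow> bool" where
  "level_set n U \<longleftrightarrow> U \<subseteq> \<Omega> \<and>
    (\<forall>f\<in>U. \<forall>g\<in>\<Omega>. (\<forall>x\<in>canonical. cl n (f (line x)) = cl n (g (line x))) \<longrightarrow> g \<in> U)"

lemma openin_level_set:
  fixes U :: "(('k ^ 'd::{finite,linorder}) set \<Rightarrow> ('k, 'd) vec) set"
  assumes "level_set n U"
  shows "openin \<Omega>_topology U"
proof -
  interpret O: Metric_space "\<Omega> :: (('k, 'd) vec set \<Rightarrow> ('k, 'd) vec) set" \<Omega>_dist
    by (rule Metric_space_\<Omega>)
  have "\<exists>r>0. O.mball f r \<subseteq> U" if f: "f \<in> U" for f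
  proof (intro exI[of _ "1 / real q ^ n"] conjI subsetI)
    show "0 < 1 / real q ^ n"
      using q_pos by simp
    fix g assume "g \<in> O.mball f (1 / real q ^ n)"
    then have g: "f \<in> \<Omega>" "g \<in> \<Omega>" "\<Omega>_dist f g < 1 / real q ^ n"
      by (auto simp: O.mball_def)
    have "cl n (f (line x)) = cl n (g (line x))" if "x \<in> canonical" for x
      using supnorm_le_\<Omega>_dist[OF g(1,2) that] g(3) by (simp add: cl_eq_iff)
    then show "g \<in> U"
      using assms f g(2) by (auto simp: level_set_def)
  qed
  then show ?thesis
    using assms unfolding \<Omega>_topology_def O.openin_mtopology level_set_def by blast
qed

lemma openin_cl: "openin vec_topology (cl n (x :: 'k ^ 'd::finite))"
proof -
  interpret V: Metric_space UNIV "\<lambda>x y :: ('k, 'd) vec. supnorm (x - y)"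
    by (rule Metric_space_supnorm)
  have "\<exists>r>0. V.mball y r \<subseteq> cl n x" if y: "y \<in> cl n x" for y
  proof (intro exI[of _ "1 / real q ^ n"] conjI subsetI)
    show "0 < 1 / real q ^ n"
      using q_pos by simp
    fix z assume "z \<in> V.mball y (1 / real q ^ n)"
    then have "supnorm (z - y) \<le> 1 / real q ^ n"
      by (simp add: V.mball_def supnorm_commute[of z])
    then show "z \<in> cl n x"
      using y supnorm_ultra unfolding cl_def by blast
  qed
  then show ?thesis
    unfolding vec_topology_def V.openin_mtopology by blast
qed

section \<open>Neighbourhoods of Kakeya sets\<close>

lemma supnorm_less_imp_le:
  assumes "x \<in> Rd" "supnorm x < real q / real q ^ n"
  shows "supnorm x \<le> 1 / real q ^ n"
  using assms(1)
proof (cases rule: Rd_supnorm_cases)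
  case 1
  then show ?thesis
    using q_pos by (simp add: supnorm_eq_0[THEN iffD2])
next
  case (2 j)
  then have "1 / real q ^ j < real q / real q ^ n"
    using assms(2) by simp
  then have "real q ^ n < real q ^ Suc j"
    using q_pos by (simp add: field_simps)
  then have "n < Suc j"
    using q_pos power_less_imp_less_exp by blast
  then show ?thesis
    using 2 inverse_power_mono[of n j] by simp
qed

text \<open>The infimum is handled by discreteness instead of compactness. If it is at most q^-n, it
  is below q^(1-n), so some point of the set is at distance less than q^(1-n); distances within
  \<open>Rd\<close> then force at most q^-n.\<close>

lemma kakeya_nbhd_iff:
  fixes f :: "('k ^ 'd::{finite,linorder}) set \<Rightarrow> ('k, 'd) vec"
  assumes f: "f \<in> \<Omega>"
  shows "x \<in> kakeya_nbhd n f \<longleftrightarrow> x \<in> Rd \<and> (\<exists>a\<in>canonical. meets_line n a (x - f (line a)))"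
proof (cases "x \<in> Rd")
  case x: True
  have K: "kakeya f = (\<Union>a\<in>canonical. {t *s a + f (line a) |t. t \<in> R})"
    unfolding kakeya_def proj_space_eq by (simp add: line_proj_space)
  have Rd: "y \<in> Rd" if "y \<in> kakeya f" for y
    using that \<Omega>_D(2)[OF f] by (auto simp: K canonical_Rd intro!: Rd_add Rd_scale)
  have "kakeya f \<noteq> {}"
    using proj_space_nonempty R_simps by (auto simp: kakeya_def)
  moreover have bdd: "bdd_below ((\<lambda>y. supnorm (x - y)) ` kakeya f)"
    using supnorm_nonneg by (intro bdd_belowI2[of _ 0])
  ultimately have "(INF y\<in>kakeya f. supnorm (x - y)) < real q / real q ^ n \<longleftrightarrow>
      (\<exists>y\<in>kakeya f. supnorm (x - y) < real q / real q ^ n)"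
    by (rule cINF_less_iff)
  moreover have "1 / real q ^ n < real q / real q ^ n"
    using q_pos by (simp add: divide_strict_right_mono)
  ultimately have "(INF y\<in>kakeya f. supnorm (x - y)) \<le> 1 / real q ^ n \<longleftrightarrow>
      (\<exists>y\<in>kakeya f. supnorm (x - y) \<le> 1 / real q ^ n)"
    using supnorm_less_imp_le Rd x Rd_diff cINF_lower2[OF bdd] by (meson le_less_trans)
  also have "\<dots> \<longleftrightarrow> (\<exists>a\<in>canonical. meets_line n a (x - f (line a)))"
    by (auto simp: K meets_line_def algebra_simps)
  finally show ?thesis
    using x by (simp add: kakeya_nbhd_def)
qed (simp add: kakeya_nbhd_def)

text \<open>Point and map may vary together: a fixed point gives that the event depends on
  \<open>f\<close> modulo \<open>\<pi> ^ n\<close>, a fixed map that the neighbourhood is a union of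
  classes.\<close>

lemma kakeya_nbhd_cong:
  fixes f g :: "('k ^ 'd::{finite,linorder}) set \<Rightarrow> ('k, 'd) vec"
  assumes f: "f \<in> \<Omega>" and g: "g \<in> \<Omega>"
    and eq: "\<And>a. a \<in> canonical \<Longrightarrow> cl n (x - f (line a)) = cl n (y - g (line a))"
    and y: "y \<in> Rd" and x: "x \<in> kakeya_nbhd n f"
  shows "y \<in> kakeya_nbhd n g"
  using x y eq meets_line_cong[OF refl] unfolding kakeya_nbhd_iff[OF f] kakeya_nbhd_iff[OF g] by blast

lemma level_set_kakeya_nbhd:
  "level_set n {f \<in> \<Omega>. (x :: 'k ^ 'd::{finite,linorder}) \<in> kakeya_nbhd n f}"
proof -
  have "x \<in> kakeya_nbhd n g"
    if fg: "f \<in> \<Omega>" "g \<in> \<Omega>" "\<forall>a\<in>canonical. cl n (f (line a)) = cl n (g (line a))"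
      and x: "x \<in> kakeya_nbhd n f" for f g
  proof (rule kakeya_nbhd_cong[OF fg(1,2) _ _ x])
    show "x \<in> Rd"
      using x kakeya_nbhd_iff[OF fg(1)] by blast
    fix a :: "('k, 'd) vec" assume "a \<in> canonical"
    then show "cl n (x - f (line a)) = cl n (x - g (line a))"
      using fg(3) by (simp add: cl_eq_iff supnorm_commute)
  qed
  then show ?thesis
    unfolding level_set_def by blast
qed

lemma kakeya_nbhd_translate:
  fixes x :: "'k ^ 'd::{finite,linorder}"
  assumes x: "x \<in> Rd"
  shows "{f \<in> \<Omega>. x \<in> kakeya_nbhd n f} = add\<Omega> (\<lambda>a\<in>proj_space. x) ` {f \<in> \<Omega>. 0 \<in> kakeya_nbhd n f}"
    (is "?L = add\<Omega> ?c ` ?N")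
proof -
  have c: "?c \<in> \<Omega>"
    using x by (rule const_\<Omega>)
  have iff: "x \<in> kakeya_nbhd n (add\<Omega> ?c f) \<longleftrightarrow> 0 \<in> kakeya_nbhd n f" if f: "f \<in> \<Omega>" for f
  proof -
    have "x - add\<Omega> ?c f (line a) = 0 - f (line a)" if "a \<in> canonical" for a
      using that by (simp add: add\<Omega>_line line_proj_space)
    then show ?thesis
      using x by (simp add: kakeya_nbhd_iff[OF f] kakeya_nbhd_iff[OF add\<Omega>_in_\<Omega>[OF c f]] Rd_0)
  qed
  show ?thesis
  proof (intro equalityI subsetI)
    fix f assume f: "f \<in> ?L"
    let ?g = "add\<Omega> (\<lambda>l\<in>proj_space. - ?c l) f"
    have f\<Omega>: "f \<in> \<Omega>"
      using f by blast
    have g: "?g \<in> \<Omega>"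
      by (intro add\<Omega>_in_\<Omega> uminus_\<Omega> c f\<Omega>)
    have eq: "add\<Omega> ?c ?g = f"
      by (rule add\<Omega>_uminus[OF f\<Omega>])
    have "0 \<in> kakeya_nbhd n ?g"
      using iff[OF g] f unfolding eq by blast
    with g have "?g \<in> ?N"
      by blast
    with eq[symmetric] show "f \<in> add\<Omega> ?c ` ?N"
      by (rule image_eqI)
  next
    fix f assume "f \<in> add\<Omega> ?c ` ?N"
    then show "f \<in> ?L"
      using iff add\<Omega>_in_\<Omega>[OF c] by auto
  qed
qed


text \<open>
  For \<open>g\<close> in \<open>level_maps n A Y\<close> these sets are the cosets of an open subgroup of \<open>\<Omega>\<close>.
\<close>

definition cylinder ::
    "nat \<Rightarrow> ('k ^ 'd::{finite,linorder}) set \<Rightarrow> ('k ^ 'd::{finite,linorder} \<Rightarrow> 'k ^ 'd::{finite,linorder})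
      \<Rightarrow> (('k ^ 'd::{finite,linorder}) set \<Rightarrow> 'k ^ 'd::{finite,linorder}) set" where
  "cylinder n A g = {f \<in> \<Omega>. \<forall>a\<in>A. cl n (f (line a)) = cl n (g a)}"

lemma level_set_cylinder:
  fixes A :: "('k ^ 'd::{finite,linorder}) set"
  assumes "A \<subseteq> canonical"
  shows "level_set n (cylinder n A g)"
  using assms by (force simp: level_set_def cylinder_def)

section \<open>Reduction of 1-Lipschitz maps to labellings\<close>

lemma transversal_obtains:
  assumes "transversal n S A" "x \<in> S"
  obtains a where "a \<in> A" "cl n x = cl n a"
proof -
  have "cl n x \<in> cl n ` A"
    using assms by (simp add: transversal_def)
  then show ?thesis
    using that by blast
qed

lemma transversal_unique:
  "\<lbrakk>transversal n S A; a \<in> A; b \<in> A; cl n a = cl n b\<rbrakk> \<Longrightarrow> a = b"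
  by (auto simp: transversal_def inj_on_def)

text \<open>The extension is constant on classes at level \<open>n\<close>, with \<rho> sending a
  point to its representative in \<open>A\<close>. Points at distance at most q^-n get equal values;
  otherwise the distance is q^-j with \<open>j\<close> at most \<open>n\<close>, and compatibility
  at level \<open>j\<close> is the Lipschitz bound.\<close>

lemma level_map_extends:
  fixes A Y :: "('k ^ 'd::{finite,linorder}) set"
  assumes A: "transversal n canonical A" and Y: "transversal n Rd Y" and g: "g \<in> level_maps n A Y"
  obtains f where "f \<in> \<Omega>" "\<And>a. a \<in> A \<Longrightarrow> f (line a) = g a"
proof -
  have gY: "g a \<in> Rd" if "a \<in> A" for a
    using g Y that by (auto simp: level_maps_def transversal_def)
  have gj: "cl j (g a) = cl j (g b)" if "j \<le> n" "a \<in> A" "b \<in> A" "cl j a = cl j b" for j a b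
    using g that unfolding level_maps_def by blast
  have "\<forall>x\<in>canonical. \<exists>a. a \<in> A \<and> cl n x = cl n a"
    using transversal_obtains[OF A] by metis
  then obtain \<rho> where \<rho>: "\<And>x. x \<in> canonical \<Longrightarrow> \<rho> x \<in> A" "\<And>x. x \<in> canonical \<Longrightarrow> cl n x = cl n (\<rho> x)"
    by metis
  define f where "f = (\<lambda>l\<in>proj_space. g (\<rho> (can l)))"
  have f_line: "f (line x) = g (\<rho> x)" if "x \<in> canonical" for x
    using that by (simp add: f_def line_proj_space)
  have "f \<in> \<Omega>"
  proof (rule \<Omega>_I)
    fix x y :: "('k, 'd) vec" assume x: "x \<in> canonical" and y: "y \<in> canonical"
    have le: "supnorm (f (line x) - f (line y)) \<le> 1 / real q ^ j"
      if j: "j \<le> n" "supnorm (x - y) \<le> 1 / real q ^ j" for j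
    proof -
      have "cl j (\<rho> x) = cl j x" "cl j (\<rho> y) = cl j y"
        using cl_mono[OF \<rho>(2)[OF x] j(1)] cl_mono[OF \<rho>(2)[OF y] j(1)] by simp_all
      moreover have "cl j x = cl j y"
        using j(2) by (simp add: cl_eq_iff)
      ultimately have "cl j (\<rho> x) = cl j (\<rho> y)"
        by simp
      then have "cl j (g (\<rho> x)) = cl j (g (\<rho> y))"
        using gj[OF j(1) \<rho>(1)[OF x] \<rho>(1)[OF y]] by simp
      then show ?thesis
        by (simp add: f_line x y cl_eq_iff)
    qed
    have eq: "f (line x) = f (line y)" if "supnorm (x - y) \<le> 1 / real q ^ n"
    proof -
      have "cl n (\<rho> x) = cl n (\<rho> y)"
        using \<rho>(2)[OF x] \<rho>(2)[OF y] that by (simp flip: cl_eq_iff)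
      then have "\<rho> x = \<rho> y"
        using transversal_unique[OF A] \<rho>(1) x y by blast
      then show ?thesis
        by (simp add: f_line x y)
    qed
    show "supnorm (f (line x) - f (line y)) \<le> supnorm (x - y)"
    proof (cases "supnorm (x - y) \<le> 1 / real q ^ n")
      case True
      then show ?thesis
        using eq supnorm_nonneg[of "x - y"] by (simp add: supnorm_eq_0[THEN iffD2])
    next
      case False
      have "x - y \<in> Rd"
        using x y by (intro Rd_diff canonical_Rd)
      then show ?thesis
      proof (cases rule: Rd_supnorm_cases)
        case 1
        then show ?thesis
          by simp
      next
        case (2 j)
        then have "j \<le> n"
          using False inverse_power_mono[of n j] by (cases "j \<le> n") auto
        then show ?thesis
          using le[of j] 2 by simp
      qed
    qed
  qed (simp_all add: f_line \<rho> gY, simp add: f_def)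
  moreover have "f (line a) = g a" if "a \<in> A" for a
  proof -
    have a: "a \<in> canonical"
      using A that by (auto simp: transversal_def)
    then have "\<rho> a = a"
      using transversal_unique[OF A _ that] \<rho> by metis
    then show ?thesis
      using f_line[OF a] by simp
  qed
  ultimately show ?thesis
    using that by blast
qed

lemma cylinder_translate:
  fixes A Y :: "('k ^ 'd::{finite,linorder}) set"
  assumes A: "transversal n canonical A" and Y: "transversal n Rd Y" and g: "g \<in> level_maps n A Y"
  shows "\<exists>h\<in>\<Omega>. cylinder n A g = add\<Omega> h ` cylinder n A (\<lambda>_. 0)"
proof -
  obtain h where h: "h \<in> \<Omega>" "\<And>a. a \<in> A \<Longrightarrow> h (line a) = g a"
    using level_map_extends[OF A Y g] by blast
  have canonical: "a \<in> canonical" if "a \<in> A" for a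
    using A that by (auto simp: transversal_def)
  have iff: "add\<Omega> h f \<in> cylinder n A g \<longleftrightarrow> f \<in> cylinder n A (\<lambda>_. 0)" if "f \<in> \<Omega>" for f
    using that add\<Omega>_in_\<Omega>[OF h(1) that]
    by (simp add: cylinder_def add\<Omega>_line canonical h(2) cl_eq_iff)
  have "cylinder n A g = add\<Omega> h ` cylinder n A (\<lambda>_. 0)"
  proof (intro equalityI subsetI)
    fix f assume f: "f \<in> cylinder n A g"
    let ?f = "add\<Omega> (\<lambda>l\<in>proj_space. - h l) f"
    have f\<Omega>: "f \<in> \<Omega>"
      using f by (simp add: cylinder_def)
    have f': "?f \<in> \<Omega>"
      by (intro add\<Omega>_in_\<Omega> uminus_\<Omega> h(1) f\<Omega>)
    have eq: "add\<Omega> h ?f = f"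
      by (rule add\<Omega>_uminus[OF f\<Omega>])
    have "?f \<in> cylinder n A (\<lambda>_. 0)"
      using iff[OF f'] f unfolding eq by blast
    with eq[symmetric] show "f \<in> add\<Omega> h ` cylinder n A (\<lambda>_. 0)"
      by (rule image_eqI)
  next
    fix f assume "f \<in> add\<Omega> h ` cylinder n A (\<lambda>_. 0)"
    then obtain f' where "f = add\<Omega> h f'" "f' \<in> cylinder n A (\<lambda>_. 0)"
      by blast
    then show "f \<in> cylinder n A g"
      using iff[of f'] by (simp add: cylinder_def)
  qed
  then show ?thesis
    using h(1) by blast
qed

text \<open>The cylinders partition \<Omega>. Rounding the values of \<open>f\<close> to
  \<open>Y\<close> changes nothing modulo \<open>\<pi> ^ n\<close>, so the rounded map inherits all
  congruences at levels up to \<open>n\<close>.\<close>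

lemma ex1_cylinder:
  fixes A Y :: "('k ^ 'd::{finite,linorder}) set"
  assumes A: "transversal n canonical A" and Y: "transversal n Rd Y" and f: "f \<in> \<Omega>"
  shows "\<exists>!g. g \<in> level_maps n A Y \<and> f \<in> cylinder n A g"
proof (rule ex_ex1I)
  have canonical: "a \<in> canonical" if "a \<in> A" for a
    using A that by (auto simp: transversal_def)
  have "\<forall>a\<in>A. \<exists>y. y \<in> Y \<and> cl n (f (line a)) = cl n y"
    using transversal_obtains[OF Y \<Omega>_D(2)[OF f canonical]] by metis
  then obtain g0 where g0: "\<And>a. a \<in> A \<Longrightarrow> g0 a \<in> Y \<and> cl n (f (line a)) = cl n (g0 a)"
    by metis
  define g where "g = restrict g0 A"
  have g: "g \<in> A \<rightarrow>\<^sub>E Y" "\<And>a. a \<in> A \<Longrightarrow> cl n (f (line a)) = cl n (g a)"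
    using g0 by (simp_all add: g_def)
  have "cl j (g a) = cl j (g b)" if j: "j \<le> n" and ab: "a \<in> A" "b \<in> A" "cl j a = cl j b" for j a b
  proof -
    have "cl j (g a) = cl j (f (line a))" "cl j (g b) = cl j (f (line b))"
      using cl_mono[OF g(2)[OF ab(1)] j] cl_mono[OF g(2)[OF ab(2)] j] by simp_all
    then show ?thesis
      using \<Omega>_cl[OF f canonical[OF ab(1)] canonical[OF ab(2)] ab(3)] by simp
  qed
  then have "g \<in> level_maps n A Y"
    using g(1) unfolding level_maps_def by blast
  moreover have "f \<in> cylinder n A g"
    using f g(2) by (simp add: cylinder_def)
  ultimately show "\<exists>g. g \<in> level_maps n A Y \<and> f \<in> cylinder n A g"
    by blast
next
  fix g g'
  assume g: "g \<in> level_maps n A Y \<and> f \<in> cylinder n A g"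
    and g': "g' \<in> level_maps n A Y \<and> f \<in> cylinder n A g'"
  have "g a = g' a" if a: "a \<in> A" for a
  proof (rule transversal_unique[OF Y])
    show "g a \<in> Y" "g' a \<in> Y"
      using g g' a by (auto simp: level_maps_def)
    show "cl n (g a) = cl n (g' a)"
      using g g' a unfolding cylinder_def by blast
  qed
  moreover have "g \<in> extensional A" "g' \<in> extensional A"
    using g g' by (auto simp: level_maps_def PiE_def)
  ultimately show "g = g'"
    by (intro extensionalityI)
qed

text \<open>The distance from 0 involves \<open>- f (line a)\<close>, but the segment of multiples
  of \<open>a\<close> by \<open>R\<close> is symmetric, which removes the sign. Passing to the
  finite set \<open>A\<close> is possible because survival depends only on classes.\<close>

lemma zero_in_kakeya_nbhd_iff:
  fixes A :: "('k ^ 'd::{finite,linorder}) set"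
  assumes A: "transversal n canonical A" and f: "f \<in> cylinder n A g"
  shows "0 \<in> kakeya_nbhd n f \<longleftrightarrow> (\<exists>a\<in>A. meets_line n a (g a))"
proof -
  have f\<Omega>: "f \<in> \<Omega>" and fg: "\<And>a. a \<in> A \<Longrightarrow> cl n (f (line a)) = cl n (g a)"
    using f unfolding cylinder_def by blast+
  have uminus: "meets_line n a (- y)" if m: "meets_line n a y" for a y :: "('k, 'd) vec"
  proof -
    obtain t where t: "t \<in> R" "supnorm (y - t *s a) \<le> 1 / real q ^ n"
      using m by (auto simp: meets_line_def)
    have "- y - (- t) *s a = - (y - t *s a)"
      by (simp add: vec_eq_iff)
    then have "supnorm (- y - (- t) *s a) \<le> 1 / real q ^ n"
      using t(2) supnorm_minus by metis
    then show ?thesis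
      using R_minus[OF t(1)] unfolding meets_line_def by blast
  qed
  have "0 \<in> kakeya_nbhd n f \<longleftrightarrow> (\<exists>a\<in>canonical. meets_line n a (- f (line a)))"
    by (simp add: kakeya_nbhd_iff[OF f\<Omega>] Rd_0)
  also have "\<dots> \<longleftrightarrow> (\<exists>a\<in>canonical. meets_line n a (f (line a)))"
    using uminus[of _ "f _"] uminus[of _ "- f _"] by (metis minus_minus)
  also have "\<dots> \<longleftrightarrow> (\<exists>a\<in>A. meets_line n a (f (line a)))"
  proof
    assume "\<exists>a\<in>canonical. meets_line n a (f (line a))"
    then obtain x where x: "x \<in> canonical" "meets_line n x (f (line x))"
      by blast
    obtain a where a: "a \<in> A" "cl n x = cl n a"
      using transversal_obtains[OF A x(1)] .
    then have "a \<in> canonical"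
      using A by (auto simp: transversal_def)
    then have "meets_line n a (f (line a))"
      using meets_line_cong[OF a(2) \<Omega>_cl[OF f\<Omega> x(1) _ a(2)] x(2)] by simp
    then show "\<exists>a\<in>A. meets_line n a (f (line a))"
      using a(1) by blast
  qed (use A in \<open>auto simp: transversal_def\<close>)
  also have "\<dots> \<longleftrightarrow> (\<exists>a\<in>A. meets_line n a (g a))"
    using meets_line_cong[OF refl fg] meets_line_cong[OF refl fg[symmetric]] by blast
  finally show ?thesis .
qed

section \<open>Probabilities and the expectation\<close>

context
  fixes P :: "(('k ^ 'd::{finite,linorder}) set \<Rightarrow> ('k, 'd) vec) measure"
  assumes P: "haar_measure \<Omega>_topology add\<Omega> P" and prob_P: "prob_space P"
begin

interpretation prob_space P
  by (rule prob_P)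

lemma topspace_\<Omega>: "topspace \<Omega>_topology = (\<Omega> :: (('k, 'd) vec set \<Rightarrow> ('k, 'd) vec) set)"
proof -
  interpret O: Metric_space "\<Omega> :: (('k, 'd) vec set \<Rightarrow> ('k, 'd) vec) set" \<Omega>_dist
    by (rule Metric_space_\<Omega>)
  show ?thesis
    by (simp add: \<Omega>_topology_def)
qed

lemma space_P: "space P = \<Omega>"
  using P by (simp add: haar_measure_def topspace_\<Omega>)

lemma level_set_sets: "level_set n U \<Longrightarrow> U \<in> sets P"
  using P openin_level_set[of n U] by (auto simp: haar_measure_def intro: sigma_sets.Basic)

lemma prob_translate: "\<lbrakk>h \<in> \<Omega>; U \<in> sets P\<rbrakk> \<Longrightarrow> prob (add\<Omega> h ` U) = prob U"
  using P by (simp add: haar_measure_def topspace_\<Omega> measure_def)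

text \<open>Uniform distribution of the reduction: the cylinders are disjoint translates of one
  another, so probabilities are cardinalities up to one common factor.\<close>

lemma prob_level:
  assumes A: "transversal n canonical A" and Y: "transversal n Rd Y" and T: "T \<subseteq> level_maps n A Y"
  shows "prob (\<Union>g\<in>T. cylinder n A g) = real (card T) * prob (cylinder n A (\<lambda>_. 0))"
proof -
  have "canonical \<subseteq> Rd"
    using canonical_Rd by blast
  then have sub: "A \<subseteq> canonical" "finite A" "finite Y"
    using A finite_transversal[OF A] finite_transversal[OF Y] by (auto simp: transversal_def)
  then have "finite (level_maps n A Y)"
    by (intro finite_subset[OF _ finite_PiE[of A "\<lambda>_. Y"]]) (auto simp: level_maps_def)
  then have fin: "finite T"
    using T by (rule finite_subset[rotated])
  have sets: "cylinder n A g \<in> sets P" for g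
    using level_set_cylinder[OF sub(1)] by (rule level_set_sets)
  have "disjoint_family_on (cylinder n A) T"
    unfolding disjoint_family_on_def
  proof (intro ballI impI)
    fix g g' assume g: "g \<in> T" "g' \<in> T" "g \<noteq> g'"
    have "g = g'" if f: "f \<in> cylinder n A g" "f \<in> cylinder n A g'" for f
    proof -
      have "f \<in> \<Omega>"
        using f(1) by (simp add: cylinder_def)
      then show ?thesis
        using ex1_cylinder[OF A Y, of f] f g(1,2) T by blast
    qed
    then show "cylinder n A g \<inter> cylinder n A g' = {}"
      using g(3) by blast
  qed
  then have "prob (\<Union>g\<in>T. cylinder n A g) = (\<Sum>g\<in>T. prob (cylinder n A g))"
    using fin sets by (intro finite_measure_finite_Union) auto
  also have "\<dots> = (\<Sum>g\<in>T. prob (cylinder n A (\<lambda>_. 0)))"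
  proof (rule sum.cong[OF refl])
    fix g assume "g \<in> T"
    then obtain h where "h \<in> \<Omega>" "cylinder n A g = add\<Omega> h ` cylinder n A (\<lambda>_. 0)"
      using cylinder_translate[OF A Y] T by blast
    then show "prob (cylinder n A g) = prob (cylinder n A (\<lambda>_. 0))"
      using prob_translate sets by simp
  qed
  finally show ?thesis
    by simp
qed

lemma prob_zero_in_kakeya_nbhd:
  assumes n: "0 < n" and d: "2 \<le> CARD('d)"
    and u_0: "u 0 = 1"
    and u_Suc: "\<And>m. u (Suc m) = 1 - (1 - u m / real q ^ (CARD('d) - 1)) ^ (q ^ (CARD('d) - 1))"
  shows "prob {f \<in> \<Omega>. 0 \<in> kakeya_nbhd n f} = 1 - (1 - u n) powr (\<Sum>i<CARD('d). 1 / real q ^ i)"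
proof -
  obtain A Y :: "('k, 'd) vec set" where A: "transversal n canonical A" and Y: "transversal n Rd Y"
    using ex_transversal by blast
  let ?E = "{f \<in> (\<Omega> :: (('k, 'd) vec set \<Rightarrow> ('k, 'd) vec) set). 0 \<in> kakeya_nbhd n f}"
  let ?M = "level_maps n A Y"
  let ?B = "{g \<in> ?M. \<forall>a\<in>A. \<not> meets_line n a (g a)}"
  let ?p = "prob (cylinder n A (\<lambda>_. 0))"
  have "(\<Union>g\<in>?M. cylinder n A g) = \<Omega>"
    using ex1_cylinder[OF A Y] by (fastforce simp: cylinder_def)
  \<comment> \<open>Applied to all labellings, \<open>prob_level\<close> determines the common
    factor \<open>?p\<close>.\<close>
  then have one: "1 = real (card ?M) * ?p"
    using prob_level[OF A Y order_refl] prob_space by (simp add: space_P)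
  have "\<Omega> - ?E = (\<Union>g\<in>?B. cylinder n A g)"
  proof (intro equalityI subsetI)
    fix f assume f: "f \<in> \<Omega> - ?E"
    then obtain g where "g \<in> ?M" "f \<in> cylinder n A g"
      using ex1_cylinder[OF A Y] by blast
    then show "f \<in> (\<Union>g\<in>?B. cylinder n A g)"
      using f zero_in_kakeya_nbhd_iff[OF A] by blast
  next
    fix f assume "f \<in> (\<Union>g\<in>?B. cylinder n A g)"
    then obtain g where "g \<in> ?B" "f \<in> cylinder n A g"
      by blast
    then show "f \<in> \<Omega> - ?E"
      using zero_in_kakeya_nbhd_iff[OF A] by (auto simp: cylinder_def)
  qed
  moreover have "?E \<in> sets P"
    using level_set_kakeya_nbhd by (rule level_set_sets)
  ultimately have "1 - prob ?E = prob (\<Union>g\<in>?B. cylinder n A g)"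
    using prob_compl[of ?E] by (simp add: space_P)
  also have "\<dots> = real (card ?B) * ?p"
    using A Y by (rule prob_level) blast
  also have "\<dots> = (1 - u n) powr (\<Sum>i<CARD('d). 1 / real q ^ i) * (real (card ?M) * ?p)"
    using card_level_maps_avoiding[OF A Y n d, of u] u_0 u_Suc by simp
  finally show ?thesis
    using one by simp
qed

text \<open>The neighbourhood is a finite union of classes modulo \<open>\<pi> ^ n\<close>, so the
  exchange of expectation and volume is linearity over \<open>Y\<close>. By translation every class
  contributes the same probability, and the weights add up to the measure of
  \<open>Rd\<close>.\<close>

lemma expectation_X:
  assumes \<mu>: "haar_measure vec_topology (+) \<mu>" and \<mu>_Rd: "emeasure \<mu> Rd = 1"
  shows "expectation (X \<mu> n) = prob {f \<in> \<Omega>. 0 \<in> kakeya_nbhd n f}"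
proof -
  obtain Y :: "('k, 'd) vec set" where Y: "transversal n Rd Y"
    using ex_transversal by blast
  have Y_Rd: "Y \<subseteq> Rd" and fin: "finite Y"
    using Y finite_transversal[OF Y] by (auto simp: transversal_def)
  have sets: "cl n x \<in> sets \<mu>" for x
    using \<mu> openin_cl[of n x] by (auto simp: haar_measure_def intro: sigma_sets.Basic)
  have cl_Rd: "cl n z \<subseteq> Rd" if "z \<in> Rd" for z :: "('k, 'd) vec"
  proof
    fix x assume "x \<in> cl n z"
    then have "supnorm (x - z) \<le> 1 / real q ^ 0"
      using inverse_power_mono[of 0 n] by (simp add: cl_def)
    then show "x \<in> Rd"
      using Rd_add[of "x - z" z] that by (simp add: Rd_iff)
  qed
  have Rd_eq: "Rd = (\<Union>z\<in>Y. cl n z)"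
  proof (intro equalityI subsetI)
    fix x :: "('k, 'd) vec" assume "x \<in> Rd"
    then obtain z where "z \<in> Y" "cl n x = cl n z"
      using transversal_obtains[OF Y] by blast
    then show "x \<in> (\<Union>z\<in>Y. cl n z)"
      using cl_self[of x n] by blast
  qed (use cl_Rd Y_Rd in blast)
  have disj: "disjoint_family_on (cl n) Y"
    unfolding disjoint_family_on_def
  proof (intro ballI impI)
    fix y z assume yz: "y \<in> Y" "z \<in> Y" "y \<noteq> z"
    have "cl n x = cl n w" if "x \<in> cl n w" for x w :: "('k, 'd) vec"
      using that by (simp add: cl_eq_iff) (simp add: cl_def)
    then show "cl n y \<inter> cl n z = {}"
      using transversal_unique[OF Y yz(1,2)] yz(3) by blast
  qed
  \<comment> \<open>Additivity of the real-valued \<open>measure\<close> requires finite values;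
    containment in \<open>Rd\<close> supplies them.\<close>
  have "emeasure \<mu> (cl n z) \<le> 1" if "z \<in> Y" for z
  proof -
    have "Rd \<in> sets \<mu>"
      unfolding Rd_eq using fin sets by blast
    then show ?thesis
      using emeasure_mono[OF cl_Rd[of z], of \<mu>] that Y_Rd \<mu>_Rd by auto
  qed
  then have finite_cl: "emeasure \<mu> (cl n z) \<noteq> \<infinity>" if "z \<in> Y" for z
    using that by (metis ennreal_one_less_top infinity_ennreal_def leD)
  have measure_Un: "measure \<mu> (\<Union>z\<in>Z. cl n z) = (\<Sum>z\<in>Z. measure \<mu> (cl n z))" if "Z \<subseteq> Y" for Z
    using that fin sets finite_cl disjoint_family_on_mono[OF that disj]
    by (intro measure_finite_Union) (auto intro: finite_subset)
  have nbhd: "kakeya_nbhd n f = (\<Union>z\<in>{z \<in> Y. z \<in> kakeya_nbhd n f}. cl n z)" if f: "f \<in> \<Omega>" for f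
  proof -
    have trans: "y \<in> kakeya_nbhd n f"
      if x: "x \<in> kakeya_nbhd n f" and y: "y \<in> Rd" "cl n x = cl n y" for x y
    proof (rule kakeya_nbhd_cong[OF f f _ y(1) x])
      show "cl n (x - f (line a)) = cl n (y - f (line a))" for a
        using y(2) by (simp add: cl_eq_iff)
    qed
    show ?thesis
    proof (intro equalityI subsetI)
      fix x assume x: "x \<in> kakeya_nbhd n f"
      then have "x \<in> Rd"
        using kakeya_nbhd_iff[OF f] by blast
      then obtain z where z: "z \<in> Y" "cl n x = cl n z"
        using transversal_obtains[OF Y] by blast
      then have "z \<in> kakeya_nbhd n f"
        using trans[OF x] Y_Rd by blast
      then show "x \<in> (\<Union>z\<in>{z \<in> Y. z \<in> kakeya_nbhd n f}. cl n z)"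
        using z cl_self[of x n] by blast
    next
      fix x assume "x \<in> (\<Union>z\<in>{z \<in> Y. z \<in> kakeya_nbhd n f}. cl n z)"
      then obtain z where z: "z \<in> Y" "z \<in> kakeya_nbhd n f" "x \<in> cl n z"
        by blast
      have "cl n z = cl n x"
        using z(3) by (simp add: cl_eq_iff supnorm_commute[of z]) (simp add: cl_def)
      then show "x \<in> kakeya_nbhd n f"
        using trans[OF z(2)] cl_Rd[of z] z Y_Rd by blast
    qed
  qed
  let ?N = "\<lambda>z. {f \<in> (\<Omega> :: (('k, 'd) vec set \<Rightarrow> ('k, 'd) vec) set). z \<in> kakeya_nbhd n f}"
  have N_sets: "?N z \<in> sets P" for z
    using level_set_kakeya_nbhd by (rule level_set_sets)
  have integrable: "integrable P (indicat_real (?N z))" for z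
    using N_sets by (intro integrable_real_indicator) (simp_all add: emeasure_eq_measure)
  have X: "X \<mu> n f = (\<Sum>z\<in>Y. measure \<mu> (cl n z) * indicator (?N z) f)" if "f \<in> space P" for f
  proof -
    have f: "f \<in> \<Omega>"
      using that by (simp add: space_P)
    have "X \<mu> n f = (\<Sum>z\<in>{z \<in> Y. z \<in> kakeya_nbhd n f}. measure \<mu> (cl n z))"
      unfolding X_def by (subst nbhd[OF f]) (rule measure_Un, blast)
    also have "\<dots> = (\<Sum>z\<in>Y. measure \<mu> (cl n z) * indicator (?N z) f)"
      unfolding sum.inter_filter[OF fin] using f by (intro sum.cong) auto
    finally show ?thesis .
  qed
  have "expectation (X \<mu> n) = expectation (\<lambda>f. \<Sum>z\<in>Y. measure \<mu> (cl n z) * indicator (?N z) f)"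
    by (rule Bochner_Integration.integral_cong[OF refl X])
  also have "\<dots> = (\<Sum>z\<in>Y. measure \<mu> (cl n z) * prob (?N z))"
    using N_sets sets.sets_into_space[OF N_sets]
    by (subst Bochner_Integration.integral_sum) (auto simp: Int_absorb2 integrable)
  also have "\<dots> = (\<Sum>z\<in>Y. measure \<mu> (cl n z) * prob (?N 0))"
  proof (rule sum.cong[OF refl])
    fix z assume "z \<in> Y"
    then have z: "z \<in> Rd"
      using Y_Rd by blast
    have "prob (?N z) = prob (?N 0)"
      unfolding kakeya_nbhd_translate[OF z] using const_\<Omega>[OF z] N_sets by (rule prob_translate)
    then show "measure \<mu> (cl n z) * prob (?N z) = measure \<mu> (cl n z) * prob (?N 0)"
      by simp
  qed
  also have "\<dots> = measure \<mu> Rd * prob (?N 0)"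
    unfolding Rd_eq measure_Un[OF order_refl] by (simp add: sum_distrib_right)
  also have "measure \<mu> Rd = 1"
    using \<mu>_Rd by (simp add: measure_def)
  finally show ?thesis
    by simp
qed

end

end

theorem theorem1p18:
  fixes val :: "'k::field \<Rightarrow> int" and \<pi> :: 'k
    and \<mu> :: "('k ^ 'd::{finite,linorder}) measure"
    and P :: "(('k ^ 'd::{finite,linorder}) set \<Rightarrow> 'k ^ 'd::{finite,linorder}) measure"
    and q :: nat and u :: "nat \<Rightarrow> real" and n :: nat
  assumes K: "complete_dvf val \<pi>"
    and q: "q = discretely_valued_field.q val \<pi>"
    and d: "CARD('d) \<ge> 2"
    and \<mu>: "haar_measure (discretely_valued_field.vec_topology val \<pi>) (+) \<mu>"
    and \<mu>_Rd: "emeasure \<mu> (discretely_valued_field.Rd val) = 1"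
    and P: "haar_measure (discretely_valued_field.\<Omega>_topology val \<pi>)
              discretely_valued_field.add\<Omega> P"
    and P_prob: "prob_space P"
    and u_0: "u 0 = 1"
    and u_Suc: "\<And>m. u (Suc m) =
      1 - (1 - u m / real q ^ (CARD('d) - 1)) ^ (q ^ (CARD('d) - 1))"
    and n: "n > 0"
  shows "prob_space.expectation P (discretely_valued_field.X val \<pi> \<mu> n) =
    1 - (1 - u n) powr (\<Sum>i<CARD('d). 1 / real q ^ i)"
proof -
  interpret complete_dvf val \<pi>
    by (rule K)
  show ?thesis
    using expectation_X[OF P P_prob \<mu> \<mu>_Rd] prob_zero_in_kakeya_nbhd[OF P P_prob n d, of u] u_0 u_Suc
    unfolding q by simp
qed

end
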